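(* For every $\delta\in(0,1]$ there exists $\epsilon_c(\delta)>0$ such that, for $\epsilon\in[0,1]$: if $\epsilon>\epsilon_c(\delta)$, then the $X$-arrows with parameters $(\delta,\epsilon)$ do not percolate, and if $\epsilon<\epsilon_c(\delta)$, then the $X$-arrows with parameters $(\delta,\epsilon)$ percolate.
   Context: Let $V=\{(x,t)\in\mathbb{Z}^2 : x+t \text{ even}\}$, and let $\delta,\epsilon\in[0,1]$ be parameters. Let $(X(v))_{v\in V}$ be i.i.d. random variables with values in the set of arrow configurations $\{\nwarrow,\ \nearrow,\ \nwarrow\nearrow,\ \odot\}$ and probabilities $$P(X(v)=\nwarrow)=P(X(v)=\nearrow)=\tfrac12(1-\delta),\quad P(X(v)=\nwarrow\nearrow)=\delta(1-\epsilon),\quad P(X(v)=\odot)=\delta\epsilon .$$ If $v=(x,t)$, then $X(v)=\nwarrow$ means there is a single arrow out of $v$, pointing to $(x-1,t+1)$; $X(v)=\nearrow$ means there is a single arrow out of $v$, pointing to $(x+1,t+1)$; $X(v)=\nwarrow\nearrow$ means both of these arrows are present; $X(v)=\odot$ means there is no arrow out of $v$. A path of $X$-arrows is a (finite or infinite) sequence of vertices $v_1,v_2,v_3,\dots$ of $V$ such that for each $i$ there is an arrow from $v_i$ to $v_{i+1}$. The $X$-arrows are said to percolate if with strictly positive probability there exists an infinite path of $X$-arrows starting at the origin $(0,0)$. *)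

theory Defs
  imports "HOL-Probability.Probability"
begin

type_synonym vertex = "int \<times> int"

definition vertices :: "vertex set" where
  "vertices = {(x, t). even (x + t)}"

datatype arrows = UpLeft | UpRight | Branch | Blocked

fun targets :: "arrows \<Rightarrow> vertex \<Rightarrow> vertex set" where
  "targets UpLeft (x, t) = {(x - 1, t + 1)}"
| "targets UpRight (x, t) = {(x + 1, t + 1)}"
| "targets Branch (x, t) = {(x - 1, t + 1), (x + 1, t + 1)}"
| "targets Blocked (x, t) = {}"

fun arrow_prob :: "real \<Rightarrow> real \<Rightarrow> arrows \<Rightarrow> real" where
  "arrow_prob \<delta> \<epsilon> UpLeft = (1 - \<delta>) / 2"
| "arrow_prob \<delta> \<epsilon> UpRight = (1 - \<delta>) / 2"
| "arrow_prob \<delta> \<epsilon> Branch = \<delta> * (1 - \<epsilon>)"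
| "arrow_prob \<delta> \<epsilon> Blocked = \<delta> * \<epsilon>"

text \<open>Only meaningful for parameters in the unit interval, see \<open>pmf_arrow_pmf\<close> below.\<close>

definition arrow_pmf :: "real \<Rightarrow> real \<Rightarrow> arrows pmf" where
  "arrow_pmf \<delta> \<epsilon> = embed_pmf (arrow_prob \<delta> \<epsilon>)"

text \<open>The joint law of the i.i.d. family; the family itself is realised by the coordinate maps
  \<open>\<lambda>\<omega>. \<omega> v\<close>.\<close>

definition arrow_measure :: "real \<Rightarrow> real \<Rightarrow> (vertex \<Rightarrow> arrows) measure" where
  "arrow_measure \<delta> \<epsilon> = PiM vertices (\<lambda>_. measure_pmf (arrow_pmf \<delta> \<epsilon>))"

definition has_arrow :: "(vertex \<Rightarrow> arrows) \<Rightarrow> vertex \<Rightarrow> vertex \<Rightarrow> bool" where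
  "has_arrow \<omega> v w \<longleftrightarrow> v \<in> vertices \<and> w \<in> targets (\<omega> v) v"

definition infinite_arrow_path :: "(vertex \<Rightarrow> arrows) \<Rightarrow> (nat \<Rightarrow> vertex) \<Rightarrow> bool" where
  "infinite_arrow_path \<omega> p \<longleftrightarrow> (\<forall>i. has_arrow \<omega> (p i) (p (Suc i)))"

definition percolation_event :: "real \<Rightarrow> real \<Rightarrow> (vertex \<Rightarrow> arrows) set" where
  "percolation_event \<delta> \<epsilon> =
    {\<omega> \<in> space (arrow_measure \<delta> \<epsilon>). \<exists>p. p 0 = (0, 0) \<and> infinite_arrow_path \<omega> p}"

definition percolates :: "real \<Rightarrow> real \<Rightarrow> bool" where
  "percolates \<delta> \<epsilon> \<longleftrightarrow> measure (arrow_measure \<delta> \<epsilon>) (percolation_event \<delta> \<epsilon>) > 0"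

lemma UNIV_arrows: "(UNIV :: arrows set) = {UpLeft, UpRight, Branch, Blocked}"
  using arrows.exhaust by auto

lemma pmf_arrow_pmf:
  assumes "\<delta> \<in> {0..1}" "\<epsilon> \<in> {0..1}"
  shows "pmf (arrow_pmf \<delta> \<epsilon>) a = arrow_prob \<delta> \<epsilon> a"
  unfolding arrow_pmf_def
proof (rule pmf_embed_pmf)
  show nonneg: "0 \<le> arrow_prob \<delta> \<epsilon> b" for b
    using assms by (cases b) auto
  have fin: "finite (UNIV :: arrows set)"
    by (simp add: UNIV_arrows)
  have "(\<integral>\<^sup>+ b. ennreal (arrow_prob \<delta> \<epsilon> b) \<partial>count_space UNIV)
      = ennreal (\<Sum>b\<in>UNIV. arrow_prob \<delta> \<epsilon> b)"
    using nonneg fin by (simp add: nn_integral_count_space_finite sum_ennreal)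
  also have "(\<Sum>b\<in>UNIV. arrow_prob \<delta> \<epsilon> b) = 1"
    by (simp add: UNIV_arrows algebra_simps)
  finally show "(\<integral>\<^sup>+ b. ennreal (arrow_prob \<delta> \<epsilon> b) \<partial>count_space UNIV) = 1"
    by simp
qed

text \<open>Measurability of the percolation event: since every vertex has finitely many successors,
  an infinite path exists iff there are paths of every finite length. Without it, the value
  \<open>0\<close> of \<open>measure\<close> on non-measurable sets would make \<open>percolates\<close> meaningless.\<close>

primrec arrow_path_of_length :: "(vertex \<Rightarrow> arrows) \<Rightarrow> nat \<Rightarrow> vertex \<Rightarrow> bool" where
  "arrow_path_of_length \<omega> 0 v \<longleftrightarrow> True"
| "arrow_path_of_length \<omega> (Suc n) v \<longleftrightarrow> (\<exists>w. has_arrow \<omega> v w \<and> arrow_path_of_length \<omega> n w)"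

lemma finite_targets: "finite (targets a v)"
  by (cases "(a, v)" rule: targets.cases) auto

lemma arrow_path_of_length_antimono:
  "arrow_path_of_length \<omega> n v \<Longrightarrow> m \<le> n \<Longrightarrow> arrow_path_of_length \<omega> m v"
proof (induction n arbitrary: m v)
  case (Suc n)
  then show ?case by (cases m) (auto simp del: split_paired_Ex)
qed simp

lemma ex_infinite_arrow_path_iff:
  "(\<exists>p. p 0 = v \<and> infinite_arrow_path \<omega> p) \<longleftrightarrow> (\<forall>n. arrow_path_of_length \<omega> n v)"
proof
  assume "\<exists>p. p 0 = v \<and> infinite_arrow_path \<omega> p"
  then obtain p where p: "p 0 = v" "\<And>i. has_arrow \<omega> (p i) (p (Suc i))"
    by (auto simp: infinite_arrow_path_def)
  have "arrow_path_of_length \<omega> n (p i)" for n i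
    by (induction n arbitrary: i) (use p(2) in \<open>auto simp del: split_paired_Ex\<close>)
  with p(1) show "\<forall>n. arrow_path_of_length \<omega> n v" by metis
next
  assume v: "\<forall>n. arrow_path_of_length \<omega> n v"
  have step: "\<exists>w. (\<forall>n. arrow_path_of_length \<omega> n w) \<and> has_arrow \<omega> u w"
    if u: "\<forall>n. arrow_path_of_length \<omega> n u" for u
  proof (rule ccontr)
    assume "\<not> ?thesis"
    then have "\<forall>w. has_arrow \<omega> u w \<longrightarrow> (\<exists>n. \<not> arrow_path_of_length \<omega> n w)" by blast
    then obtain N where N: "\<And>w. has_arrow \<omega> u w \<Longrightarrow> \<not> arrow_path_of_length \<omega> (N w) w"
      by metis
    define m where "m = Max (insert 0 (N ` targets (\<omega> u) u))"
    obtain w where w: "has_arrow \<omega> u w" "arrow_path_of_length \<omega> m w"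
      using u[rule_format, of "Suc m"] by auto
    have "N w \<le> m"
      unfolding m_def using w(1) finite_targets by (intro Max_ge) (auto simp: has_arrow_def)
    with N w arrow_path_of_length_antimono show False by blast
  qed
  have "\<exists>p. p 0 = v \<and> (\<forall>i. (\<forall>n. arrow_path_of_length \<omega> n (p i)) \<and> has_arrow \<omega> (p i) (p (Suc i)))"
    using dependent_nat_choice[where P = "\<lambda>i u. (\<forall>n. arrow_path_of_length \<omega> n u) \<and> (i = 0 \<longrightarrow> u = v)"
        and Q = "\<lambda>_ u w. has_arrow \<omega> u w"] v step by (metis nat.distinct(1))
  then show "\<exists>p. p 0 = v \<and> infinite_arrow_path \<omega> p"
    by (auto simp: infinite_arrow_path_def)
qed

lemma percolation_event_measurable: "percolation_event \<delta> \<epsilon> \<in> sets (arrow_measure \<delta> \<epsilon>)"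
proof -
  have arrow: "Measurable.pred (arrow_measure \<delta> \<epsilon>) (\<lambda>\<omega>. has_arrow \<omega> v w)" for v w
  proof (cases "v \<in> vertices")
    case True
    then have "(\<lambda>\<omega>. \<omega> v) \<in> arrow_measure \<delta> \<epsilon> \<rightarrow>\<^sub>M measure_pmf (arrow_pmf \<delta> \<epsilon>)"
      unfolding arrow_measure_def by (rule measurable_component_singleton)
    moreover have "(\<lambda>a. w \<in> targets a v) \<in> measure_pmf (arrow_pmf \<delta> \<epsilon>) \<rightarrow>\<^sub>M count_space UNIV"
      by simp
    ultimately have "(\<lambda>\<omega>. w \<in> targets (\<omega> v) v) \<in> arrow_measure \<delta> \<epsilon> \<rightarrow>\<^sub>M count_space UNIV"
      by (rule measurable_compose)
    with True show ?thesis by (simp add: has_arrow_def)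
  qed (simp add: has_arrow_def)
  have "Measurable.pred (arrow_measure \<delta> \<epsilon>) (\<lambda>\<omega>. arrow_path_of_length \<omega> n v)" for n v
  proof (induction n arbitrary: v)
    case (Suc n)
    show ?case
      unfolding arrow_path_of_length.simps
      by (intro pred_intros_countable pred_intros_logic arrow Suc)
  qed simp
  then show ?thesis
    unfolding percolation_event_def ex_infinite_arrow_path_iff
    by (intro sets.sets_Collect_countable_All) (simp add: pred_def)
qed

end

theory Submission
  imports Defs
begin

text \<open>
  Thinning branch points to blocked vertices couples the models with different \<open>\<epsilon>\<close>, so percolation is
  antimonotone in \<open>\<epsilon>\<close>, and \<open>\<epsilon>\<^sub>c\<close> can be taken to be the supremum of the percolating \<open>\<epsilon>\<close>, once some
  \<open>\<epsilon> > 0\<close> percolates.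

  For the latter, a path that turns towards a target at every branch point is a walk with drift
  \<open>\<delta>\<close> towards it. An exponential Lyapunov function shows that for large \<open>r\<close> all walks
  from a window of size of order \<open>r\<close> reach both neighbouring windows with high probability, staying in a
  space-time block; then \<open>\<epsilon>\<close> is chosen so small that the block most likely has no blocked vertex.
  Failures of different blocks are independent, which gives a highly supercritical oriented site
  percolation.

  This is treated by a hierarchical renormalization instead of a contour argument: a block of sites counts as bad
  only if it contains two bad sites, since two disjoint paths get around a single one. The density of bad sites
  hence satisfies \<open>p\<^sub>k\<^sub>+\<^sub>1 \<le> C\<^sup>2 p\<^sub>k\<^sup>2\<close>, and with positive probability no bad site of any level interferes with
  a fixed neighbourhood of the starting site.
\<close>

section \<open>Events depending on finitely many coordinates\<close>

instance arrows :: finite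
  by standard (simp add: UNIV_arrows)

definition depends_on :: "'i set \<Rightarrow> (('i \<Rightarrow> 'a) \<Rightarrow> bool) \<Rightarrow> bool" where
  "depends_on F Q \<longleftrightarrow> (\<forall>\<omega> \<omega>'. (\<forall>i\<in>F. \<omega> i = \<omega>' i) \<longrightarrow> Q \<omega> = Q \<omega>')"

lemma depends_onI: "(\<And>\<omega> \<omega>'. (\<And>i. i \<in> F \<Longrightarrow> \<omega> i = \<omega>' i) \<Longrightarrow> Q \<omega> \<Longrightarrow> Q \<omega>') \<Longrightarrow> depends_on F Q"
  unfolding depends_on_def by metis

lemma depends_onD: "depends_on F Q \<Longrightarrow> (\<And>i. i \<in> F \<Longrightarrow> \<omega> i = \<omega>' i) \<Longrightarrow> Q \<omega> = Q \<omega>'"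
  unfolding depends_on_def by blast

lemma depends_on_restrict: "depends_on F Q \<Longrightarrow> Q (restrict \<omega> F) = Q \<omega>"
  by (rule depends_onD) auto

lemma depends_on_conj:
  "depends_on F Q \<Longrightarrow> depends_on G R \<Longrightarrow> depends_on (F \<union> G) (\<lambda>\<omega>. Q \<omega> \<and> R \<omega>)"
  unfolding depends_on_def by (metis UnCI)

lemma product_prob_space_pmf: "product_prob_space (\<lambda>_. measure_pmf p)"
  by unfold_locales

lemma sets_PiM_pmf_finite:
  fixes p :: "'a::finite pmf"
  assumes "finite F" "A \<subseteq> PiE F (\<lambda>_. UNIV)"
  shows "A \<in> sets (PiM F (\<lambda>_. measure_pmf p))"
proof -
  have fin: "finite A"
    by (rule finite_subset[OF assms(2) finite_PiE]) (use assms in auto)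
  have single: "{c} \<in> sets (PiM F (\<lambda>_. measure_pmf p))" if "c \<in> A" for c
  proof -
    have c: "c \<in> PiE F (\<lambda>_. UNIV)" using that assms(2) by blast
    have "(\<Pi>\<^sub>E i\<in>F. {c i}) \<in> sets (PiM F (\<lambda>_. measure_pmf p))"
      using assms by (intro sets_PiM_I_finite) auto
    moreover have "(\<Pi>\<^sub>E i\<in>F. {c i}) = {c}"
      using PiE_eq_singleton[of F "\<lambda>i. {c i}" c] c by (auto simp: PiE_iff extensional_def fun_eq_iff)
    ultimately show ?thesis by simp
  qed
  have "(\<Union>c\<in>A. {c}) \<in> sets (PiM F (\<lambda>_. measure_pmf p))"
    using fin single by (intro sets.finite_UN) auto
  then show ?thesis by simp
qed

text \<open>In a finite product of finite sets every set is a finite union of one-point boxes, and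
  the event is the preimage of such a set under restriction to \<open>F\<close>.\<close>

lemma depends_on_measurable:
  fixes p :: "'a::finite pmf"
  assumes F: "finite F" "F \<subseteq> I" and Q: "depends_on F Q"
  shows "{\<omega> \<in> space (PiM I (\<lambda>_. measure_pmf p)). Q \<omega>} \<in> sets (PiM I (\<lambda>_. measure_pmf p))"
proof -
  let ?N = "PiM I (\<lambda>_. measure_pmf p)"
  have r: "(\<lambda>\<omega>. restrict \<omega> F) \<in> ?N \<rightarrow>\<^sub>M PiM F (\<lambda>_. measure_pmf p)"
    using F by (intro measurable_restrict_subset)
  have "{c \<in> PiE F (\<lambda>_. UNIV). Q c} \<in> sets (PiM F (\<lambda>_. measure_pmf p))"
    using F by (intro sets_PiM_pmf_finite) auto
  from measurable_sets[OF r this] have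
    "(\<lambda>\<omega>. restrict \<omega> F) -` {c \<in> PiE F (\<lambda>_. UNIV). Q c} \<inter> space ?N \<in> sets ?N" .
  also have "(\<lambda>\<omega>. restrict \<omega> F) -` {c \<in> PiE F (\<lambda>_. UNIV). Q c} \<inter> space ?N = {\<omega> \<in> space ?N. Q \<omega>}"
    using depends_on_restrict[OF Q] by (auto simp: space_PiM)
  finally show ?thesis .
qed

lemma indep_vars_PiM_pmf:
  assumes "I \<noteq> {}"
  shows "prob_space.indep_vars (PiM I (\<lambda>_. measure_pmf p)) (\<lambda>_. measure_pmf p) (\<lambda>i \<omega>. \<omega> i) I"
proof -
  interpret product_prob_space "\<lambda>_. measure_pmf p" I
    by (rule product_prob_space_pmf)
  show ?thesis
  proof (subst indep_vars_iff_distr_eq_PiM'[OF assms])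
    show "(\<lambda>\<omega>. \<omega> i) \<in> PiM I (\<lambda>_. measure_pmf p) \<rightarrow>\<^sub>M measure_pmf p" if "i \<in> I" for i
      using that by (rule measurable_component_singleton)
    have "distr (PiM I (\<lambda>_. measure_pmf p)) (PiM I (\<lambda>_. measure_pmf p)) (\<lambda>x. \<lambda>i\<in>I. x i)
        = distr (PiM I (\<lambda>_. measure_pmf p)) (PiM I (\<lambda>_. measure_pmf p)) (\<lambda>x. x)"
      by (intro distr_cong) (auto simp: space_PiM PiE_def extensional_restrict)
    also have "\<dots> = PiM I (\<lambda>_. measure_pmf p)" by (rule distr_id)
    also have "\<dots> = PiM I (\<lambda>i. distr (PiM I (\<lambda>_. measure_pmf p)) (measure_pmf p) (\<lambda>\<omega>. \<omega> i))"
      by (intro PiM_cong) (auto simp: PiM_component)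
    finally show "distr (PiM I (\<lambda>_. measure_pmf p)) (PiM I (\<lambda>_. measure_pmf p)) (\<lambda>x. \<lambda>i\<in>I. x i) = \<dots>" .
  qed
qed

text \<open>Restrictions of an independent family to disjoint index sets are independent, and each
  of the two events factors through its restriction.\<close>

lemma depends_on_indep:
  fixes p :: "'a::finite pmf" and I :: "'i set"
  defines "N \<equiv> PiM I (\<lambda>_. measure_pmf p)"
  assumes F: "finite F" "F \<subseteq> I" and Q: "depends_on F Q"
      and G: "finite G" "G \<subseteq> I" and R: "depends_on G R"
      and disj: "F \<inter> G = {}" and I: "I \<noteq> {}"
  shows "measure N {\<omega> \<in> space N. Q \<omega> \<and> R \<omega>}
    = measure N {\<omega> \<in> space N. Q \<omega>} * measure N {\<omega> \<in> space N. R \<omega>}"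
proof -
  interpret product_prob_space "\<lambda>_. measure_pmf p" I
    by (rule product_prob_space_pmf)
  let ?A = "{c \<in> PiE F (\<lambda>_. UNIV). Q c}" and ?B = "{c \<in> PiE G (\<lambda>_. UNIV). R c}"
  have ind: "P.indep_var (PiM F (\<lambda>_. measure_pmf p)) (\<lambda>\<omega>. restrict (\<lambda>i. \<omega> i) F)
      (PiM G (\<lambda>_. measure_pmf p)) (\<lambda>\<omega>. restrict (\<lambda>i. \<omega> i) G)"
    by (rule P.indep_var_restrict[OF indep_vars_PiM_pmf[OF I] disj]) fact+
  have A: "?A \<in> sets (PiM F (\<lambda>_. measure_pmf p))"
    using F by (intro sets_PiM_pmf_finite) auto
  have B: "?B \<in> sets (PiM G (\<lambda>_. measure_pmf p))"
    using G by (intro sets_PiM_pmf_finite) auto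
  have 1: "(\<lambda>\<omega>. (restrict (\<lambda>i. \<omega> i) F, restrict (\<lambda>i. \<omega> i) G)) -` (?A \<times> ?B) \<inter> space N
      = {\<omega> \<in> space N. Q \<omega> \<and> R \<omega>}"
    using depends_on_restrict[OF Q] depends_on_restrict[OF R] by auto
  have 2: "(\<lambda>\<omega>. restrict (\<lambda>i. \<omega> i) F) -` ?A \<inter> space N = {\<omega> \<in> space N. Q \<omega>}"
    using depends_on_restrict[OF Q] by auto
  have 3: "(\<lambda>\<omega>. restrict (\<lambda>i. \<omega> i) G) -` ?B \<inter> space N = {\<omega> \<in> space N. R \<omega>}"
    using depends_on_restrict[OF R] by auto
  from P.indep_varD[OF ind A B] show ?thesis
    unfolding N_def[symmetric] 1 2 3 .
qed

section \<open>Monotonicity in the blocking parameter\<close>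

text \<open>A product measure is determined by its cylinders, and a coordinatewise map pulls a
  cylinder back to the cylinder of the preimages.\<close>

lemma distr_PiM_map_pmf:
  "distr (PiM I (\<lambda>_. measure_pmf p)) (PiM I (\<lambda>_. measure_pmf (map_pmf f p))) (\<lambda>\<omega>. \<lambda>i\<in>I. f (\<omega> i))
    = PiM I (\<lambda>_. measure_pmf (map_pmf f p))" (is "distr ?N ?M ?t = _")
proof -
  interpret P: product_prob_space "\<lambda>_. measure_pmf p" I by (rule product_prob_space_pmf)
  interpret R: product_prob_space "\<lambda>_. measure_pmf (map_pmf f p)" I by (rule product_prob_space_pmf)
  show ?thesis
  proof (rule R.PiM_eq)
    fix J and X :: "_ \<Rightarrow> _ set" assume J: "finite J" "J \<subseteq> I"
    have t: "?t \<in> ?N \<rightarrow>\<^sub>M ?M"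
      by (intro measurable_restrict measurable_compose[OF measurable_component_singleton]) auto
    have "distr ?N ?M ?t (prod_emb I (\<lambda>_. measure_pmf (map_pmf f p)) J (Pi\<^sub>E J X))
        = ?N (?t -` prod_emb I (\<lambda>_. measure_pmf (map_pmf f p)) J (Pi\<^sub>E J X) \<inter> space ?N)"
      using J t by (intro emeasure_distr sets_PiM_I) auto
    also have "?t -` prod_emb I (\<lambda>_. measure_pmf (map_pmf f p)) J (Pi\<^sub>E J X) \<inter> space ?N
        = prod_emb I (\<lambda>_. measure_pmf p) J (\<Pi>\<^sub>E j\<in>J. f -` X j)"
      using J by (auto simp: prod_emb_def space_PiM Pi_iff PiE_iff subset_iff split: if_splits)
    also have "?N \<dots> = (\<Prod>j\<in>J. emeasure (measure_pmf p) (f -` X j))"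
      using J by (intro P.emeasure_PiM_emb) auto
    also have "\<dots> = (\<Prod>j\<in>J. emeasure (measure_pmf (map_pmf f p)) (X j))"
      by (intro prod.cong) (auto simp: emeasure_distr map_pmf_rep_eq)
    finally show "distr ?N ?M ?t (prod_emb I (\<lambda>_. measure_pmf (map_pmf f p)) J (Pi\<^sub>E J X)) = \<dots>" .
  qed simp
qed

definition thin :: "arrows \<times> bool \<Rightarrow> arrows" where
  "thin ab = (if fst ab = Branch \<and> snd ab then Blocked else fst ab)"

text \<open>The coin must delete a branch point with the probability \<open>r\<close> that solves
  \<open>(1 - \<epsilon>) * (1 - r) = 1 - \<epsilon>'\<close>; the division by
  \<open>1 - \<epsilon>\<close> explains the condition \<open>\<epsilon> < 1\<close>.\<close>

lemma map_pmf_thin: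
  assumes \<delta>: "\<delta> \<in> {0..1}" and "0 \<le> \<epsilon>" "\<epsilon> \<le> \<epsilon>'" "\<epsilon>' \<le> 1" "\<epsilon> < 1"
  shows "map_pmf thin (pair_pmf (arrow_pmf \<delta> \<epsilon>) (bernoulli_pmf ((\<epsilon>' - \<epsilon>) / (1 - \<epsilon>)))) = arrow_pmf \<delta> \<epsilon>'"
    (is "map_pmf _ (pair_pmf ?p (bernoulli_pmf ?r)) = _")
proof (rule pmf_eqI)
  fix a
  have r: "0 \<le> ?r" "?r \<le> 1" using assms by (auto simp: field_simps)
  have "pmf (map_pmf thin (pair_pmf ?p (bernoulli_pmf ?r))) a
      = pmf (bind_pmf ?p (\<lambda>b. bind_pmf (bernoulli_pmf ?r) (\<lambda>c. return_pmf (thin (b, c))))) a"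
    by (simp add: pair_pmf_def map_bind_pmf)
  also have "\<dots> = (\<Sum>b\<in>UNIV. arrow_prob \<delta> \<epsilon> b * (?r * indicator {thin (b, True)} a + (1 - ?r) * indicator {thin (b, False)} a))"
  proof -
    have "pmf (bind_pmf (bernoulli_pmf ?r) (\<lambda>c. return_pmf (thin (b, c)))) a
        = ?r * indicator {thin (b, True)} a + (1 - ?r) * indicator {thin (b, False)} a" for b
      using r by (simp add: pmf_bind pmf_return mult.commute indicator_def)
    then show ?thesis
      unfolding pmf_bind[of ?p] using assms
      by (subst integral_measure_pmf_real[of UNIV]) (simp_all add: pmf_arrow_pmf mult.commute)
  qed
  also have "\<dots> = arrow_prob \<delta> \<epsilon>' a"
  proof -
    \<comment> \<open>Expressing \<epsilon>' through \<open>r\<close> removes the division and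
      leaves a polynomial identity for each arrow configuration.\<close>
    define r where "r = ?r"
    have "r * (1 - \<epsilon>) = \<epsilon>' - \<epsilon>" unfolding r_def using assms by simp
    then have r': "\<epsilon>' = \<epsilon> + r * (1 - \<epsilon>)" by simp
    show ?thesis unfolding r_def[symmetric] unfolding r'
      by (cases a) (simp_all add: UNIV_arrows thin_def algebra_simps)
  qed
  also have "\<dots> = pmf (arrow_pmf \<delta> \<epsilon>') a"
    using assms by (simp add: pmf_arrow_pmf)
  finally show "pmf (map_pmf thin (pair_pmf ?p (bernoulli_pmf ?r))) a = \<dots>" .
qed

lemma percolates_antimono:
  assumes \<delta>: "\<delta> \<in> {0..1}" and \<epsilon>: "0 \<le> \<epsilon>" "\<epsilon> \<le> \<epsilon>'" "\<epsilon>' \<le> 1" and perc: "percolates \<delta> \<epsilon>'"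
  shows "percolates \<delta> \<epsilon>"
proof (cases "\<epsilon> < 1")
  case False
  with \<epsilon> have "\<epsilon> = \<epsilon>'" by linarith
  with perc show ?thesis by simp
next
  case True
  define Q where "Q = pair_pmf (arrow_pmf \<delta> \<epsilon>) (bernoulli_pmf ((\<epsilon>' - \<epsilon>) / (1 - \<epsilon>)))"
  define N where "N = PiM vertices (\<lambda>_. measure_pmf Q)"
  interpret product_prob_space "\<lambda>_. measure_pmf Q" vertices by (rule product_prob_space_pmf)
  have Q: "map_pmf fst Q = arrow_pmf \<delta> \<epsilon>" "map_pmf thin Q = arrow_pmf \<delta> \<epsilon>'"
    unfolding Q_def using assms True by (auto simp: map_fst_pair_pmf map_pmf_thin)
  define t where "t f = (\<lambda>\<omega>. \<lambda>v\<in>vertices. f (\<omega> v))" for f :: "arrows \<times> bool \<Rightarrow> arrows" and \<omega> :: "vertex \<Rightarrow> arrows \<times> bool"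
  have distr: "distr N (arrow_measure \<delta> \<epsilon>) (t fst) = arrow_measure \<delta> \<epsilon>"
    "distr N (arrow_measure \<delta> \<epsilon>') (t thin) = arrow_measure \<delta> \<epsilon>'"
    using distr_PiM_map_pmf[of vertices Q fst] distr_PiM_map_pmf[of vertices Q thin]
    by (simp_all add: N_def arrow_measure_def Q t_def)
  have meas: "t fst \<in> N \<rightarrow>\<^sub>M arrow_measure \<delta> \<epsilon>" "t thin \<in> N \<rightarrow>\<^sub>M arrow_measure \<delta> \<epsilon>'"
    unfolding t_def N_def arrow_measure_def
    by (intro measurable_restrict measurable_compose[OF measurable_component_singleton]; simp)+
  \<comment> \<open>Thinning only deletes arrows, so every thinned path is a path of the original
    arrows.\<close>
  have arrow: "has_arrow (t fst \<omega>) v w" if "has_arrow (t thin \<omega>) v w" for \<omega> v w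
    using that by (cases v) (auto simp: has_arrow_def t_def thin_def split: if_splits)
  have sub: "t thin -` percolation_event \<delta> \<epsilon>' \<inter> space N \<subseteq> t fst -` percolation_event \<delta> \<epsilon> \<inter> space N"
  proof (rule subsetI)
    fix \<omega> assume "\<omega> \<in> t thin -` percolation_event \<delta> \<epsilon>' \<inter> space N"
    then have \<omega>: "\<omega> \<in> space N" "t thin \<omega> \<in> percolation_event \<delta> \<epsilon>'" by simp_all
    then obtain p where "p 0 = (0, 0)" "infinite_arrow_path (t thin \<omega>) p"
      unfolding percolation_event_def by blast
    then have "p 0 = (0, 0) \<and> infinite_arrow_path (t fst \<omega>) p"
      unfolding infinite_arrow_path_def using arrow by simp
    then have "t fst \<omega> \<in> percolation_event \<delta> \<epsilon>"
      unfolding percolation_event_def using measurable_space[OF meas(1) \<omega>(1)] by blast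
    with \<omega>(1) show "\<omega> \<in> t fst -` percolation_event \<delta> \<epsilon> \<inter> space N" by simp
  qed
  have "0 < measure (distr N (arrow_measure \<delta> \<epsilon>') (t thin)) (percolation_event \<delta> \<epsilon>')"
    using perc by (simp add: distr percolates_def)
  also have "\<dots> = measure N (t thin -` percolation_event \<delta> \<epsilon>' \<inter> space N)"
    using meas percolation_event_measurable by (intro measure_distr) auto
  also have "\<dots> \<le> measure N (t fst -` percolation_event \<delta> \<epsilon> \<inter> space N)"
    using sub measurable_sets[OF meas(1) percolation_event_measurable]
    unfolding N_def by (intro P.finite_measure_mono) auto
  also have "\<dots> = measure (distr N (arrow_measure \<delta> \<epsilon>) (t fst)) (percolation_event \<delta> \<epsilon>)"
    using meas percolation_event_measurable by (intro measure_distr[symmetric]) auto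
  finally show ?thesis by (simp add: distr percolates_def)
qed

section \<open>Renormalized lattices\<close>

text \<open>Distinct vertices in one row are at least 2 apart, so their block centres are at least
  20 apart: strict half-width 10 makes the blocks disjoint. The height 20 leaves room for two
  disjoint paths from a bottom pair to any required site above.\<close>

definition block :: "vertex \<Rightarrow> vertex set" where
  "block = (\<lambda>(x, t). {(j, n) \<in> vertices. \<bar>j - 10 * x\<bar> < 10 \<and> 20 * t \<le> n \<and> n < 20 * t + 20})"

text \<open>The renormalized lattice: a site of level \<open>k + 1\<close> stands for a \<open>block\<close> of sites of level \<open>k\<close>, and is
  bad iff this block contains two bad ones. It is active through one of two designated pairs of
  neighbouring sites, depending on whether the activity arrived from the left or from the right;
  with a single designated pair the blocks would have to overlap, and bad sites of the
  same level would not be independent.\<close>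

primrec bad :: "(vertex \<Rightarrow> bool) \<Rightarrow> nat \<Rightarrow> vertex \<Rightarrow> bool" where
  "bad B 0 v \<longleftrightarrow> B v"
| "bad B (Suc k) v \<longleftrightarrow> (\<exists>u\<in>block v. \<exists>w\<in>block v. u \<noteq> w \<and> bad B k u \<and> bad B k w)"

primrec active :: "(vertex \<Rightarrow> bool) \<Rightarrow> nat \<Rightarrow> vertex \<Rightarrow> bool" where
  "active A 0 v \<longleftrightarrow> A v"
| "active A (Suc k) v \<longleftrightarrow>
    active A k (10 * fst v - 4, 20 * snd v) \<and> active A k (10 * fst v - 2, 20 * snd v) \<or>
    active A k (10 * fst v + 2, 20 * snd v) \<and> active A k (10 * fst v + 4, 20 * snd v)"

text \<open>The only property of activity that the renormalization uses. It is established for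
  blocks of the arrow model and inherited from each level by the next.\<close>

definition spreads :: "(vertex \<Rightarrow> bool) \<Rightarrow> (vertex \<Rightarrow> bool) \<Rightarrow> bool" where
  "spreads B A \<longleftrightarrow> (\<forall>x t. (x, t) \<in> vertices \<longrightarrow> \<not> B (x, t) \<longrightarrow> A (x, t) \<longrightarrow>
    A (x - 1, t + 1) \<and> A (x + 1, t + 1))"

lemma vertices_iff [simp]: "(x, t) \<in> vertices \<longleftrightarrow> even (x + t)"
  by (simp add: vertices_def)

definition lattice_path :: "(nat \<Rightarrow> int) \<Rightarrow> nat \<Rightarrow> bool" where
  "lattice_path f m \<longleftrightarrow> (\<forall>n<m. f (Suc n) = f n - 1 \<or> f (Suc n) = f n + 1)"

lemma lattice_path_vertex:
  assumes "lattice_path f m" "(f 0, t) \<in> vertices" "n \<le> m"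
  shows "(f n, t + int n) \<in> vertices"
  using assms(3)
proof (induction n)
  case (Suc n)
  then have "f (Suc n) = f n - 1 \<or> f (Suc n) = f n + 1"
    using assms(1) by (auto simp: lattice_path_def)
  with Suc show ?case by auto
qed (use assms in simp)

lemma spreads_path:
  assumes "spreads B A" "lattice_path f m" "(f 0, t) \<in> vertices" "A (f 0, t)"
    and good: "\<And>n. n < m \<Longrightarrow> \<not> B (f n, t + int n)"
  shows "A (f m, t + int m)"
proof -
  have "n \<le> m \<Longrightarrow> A (f n, t + int n)" for n
  proof (induction n)
    case (Suc n)
    then have "f (Suc n) = f n - 1 \<or> f (Suc n) = f n + 1"
      using assms(2) by (auto simp: lattice_path_def)
    moreover have "A (f n - 1, t + int n + 1) \<and> A (f n + 1, t + int n + 1)"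
      using assms(1) Suc good[of n] lattice_path_vertex[OF assms(2,3), of n]
      by (auto simp: spreads_def)
    moreover have "t + int (Suc n) = t + int n + 1" by simp
    ultimately show ?case by metis
  qed (use assms in simp)
  then show ?thesis by simp
qed

text \<open>Two paths that only meet at their common endpoint cannot both be obstructed by a single
  bad site.\<close>

lemma spreads_two_paths:
  assumes AB: "spreads B A" and f: "lattice_path f 20" and g: "lattice_path g 20"
    and start: "A (f 0, t)" "A (g 0, t)" "even (f 0 + t)" "even (g 0 + t)"
    and ends: "f 20 = y" "g 20 = y"
    and disj: "\<And>n. n < 20 \<Longrightarrow> f n < g n"
    and inside: "\<And>n. n < 20 \<Longrightarrow> x - 10 < f n" "\<And>n. n < 20 \<Longrightarrow> g n < x + 10"
    and single: "\<And>u w. u \<in> vertices \<Longrightarrow> w \<in> vertices \<Longrightarrow>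
      \<bar>fst u - x\<bar> < 10 \<Longrightarrow> \<bar>fst w - x\<bar> < 10 \<Longrightarrow> t \<le> snd u \<Longrightarrow> t \<le> snd w \<Longrightarrow>
      snd u < t + 20 \<Longrightarrow> snd w < t + 20 \<Longrightarrow> B u \<Longrightarrow> B w \<Longrightarrow> u = w"
  shows "A (y, t + 20)"
proof (rule ccontr)
  assume *: "\<not> A (y, t + 20)"
  obtain n where n: "n < 20" "B (f n, t + int n)"
    using spreads_path[OF AB f _ start(1)] start * ends by auto
  obtain m where m: "m < 20" "B (g m, t + int m)"
    using spreads_path[OF AB g _ start(2)] start * ends by auto
  have v: "(f n, t + int n) \<in> vertices" "(g m, t + int m) \<in> vertices"
    using lattice_path_vertex[OF f, of t n] lattice_path_vertex[OF g, of t m] start n m by auto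
  have "(f n, t + int n) = (g m, t + int m)"
    using n m inside[OF n(1)] inside[OF m(1)] disj[OF n(1)] disj[OF m(1)]
    by (intro single[OF v]) auto
  with disj[OF n(1)] show False by auto
qed

text \<open>From the two bottom sites two parallel paths at distance 2 lead to the target and merge
  only in the last step; a single bad site obstructs at most one of them. The targets
  \<open>y\<close> are the sites of the designated pairs facing this block in the two successor
  blocks.\<close>

lemma spreads_block:
  assumes AB: "spreads B A"
    and single: "\<And>u w. u \<in> block (x, t) \<Longrightarrow> w \<in> block (x, t) \<Longrightarrow> B u \<Longrightarrow> B w \<Longrightarrow> u = w"
    and a: "A (10 * x + a, 20 * t)" "A (10 * x + a + 2, 20 * t)" "a = -4 \<or> a = 2"
    and y: "y \<in> {6, 8, -6, -8}"
  shows "A (10 * x + y, 20 * t + 20)"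
proof -
  let ?c = "10 * x"
  have single': "u = w" if "u \<in> vertices" "w \<in> vertices" "\<bar>fst u - ?c\<bar> < 10" "\<bar>fst w - ?c\<bar> < 10"
    "20 * t \<le> snd u" "20 * t \<le> snd w" "snd u < 20 * t + 20" "snd w < 20 * t + 20" "B u" "B w" for u w
    using that by (intro single) (auto simp: block_def)
  show ?thesis
  proof (cases "y > 0")
    case True
    \<comment> \<open>Both paths run left, then right. The path \<open>g\<close> reaches
      \<open>y + 1\<close> after 19 steps and turns back for the last one, so that it also ends at
      \<open>y\<close>. The fit is tight: \<open>f\<close> descends to offset -9 for
      \<open>a = -4\<close>, \<open>y = 6\<close>, and \<open>g\<close> climbs to offset 9 for
      \<open>y = 8\<close>.\<close>
    define f where "f n = ?c + max (a - int n) (y - 20 + int n)" for n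
    define g where "g n = (if n < 20 then ?c + max (a + 2 - int n) (y - 18 + int n) else ?c + y)" for n
    have 1: "lattice_path f 20" "lattice_path g 20"
      using a(3) y True by (auto simp: lattice_path_def f_def g_def max_def)
    show ?thesis
      by (rule spreads_two_paths[where x = ?c, OF AB 1 _ _ _ _ _ _ _ _ _ single'])
        (use a y True in \<open>auto simp: f_def g_def max_def add.commute split: if_splits\<close>)
  next
    case False
    \<comment> \<open>The mirror image: now \<open>f\<close> makes the corrective last step, from
      \<open>y - 1\<close> to \<open>y\<close>.\<close>
    define f where "f n = (if n < 20 then ?c + min (a + int n) (y + 18 - int n) else ?c + y)" for n
    define g where "g n = ?c + min (a + 2 + int n) (y + 20 - int n)" for n
    have 1: "lattice_path f 20" "lattice_path g 20"
      using a(3) y False by (auto simp: lattice_path_def f_def g_def min_def)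
    show ?thesis
      by (rule spreads_two_paths[where x = ?c, OF AB 1 _ _ _ _ _ _ _ _ _ single'])
        (use a y False in \<open>auto simp: f_def g_def min_def add.commute split: if_splits\<close>)
  qed
qed

lemma spreads_active:
  assumes "spreads B A"
  shows "spreads (bad B k) (active A k)"
proof (induction k)
  case 0
  have "bad B 0 = B" "active A 0 = A" by auto
  with assms show ?case by simp
next
  case (Suc k)
  show ?case
    unfolding spreads_def
  proof (intro allI impI)
    fix x t :: int
    assume good: "\<not> bad B (Suc k) (x, t)" and act: "active A (Suc k) (x, t)"
    have *: "active A k (10 * x + y, 20 * t + 20)" if "y \<in> {6, 8, -6, -8}" for y
    proof -
      obtain a :: int where "active A k (10 * x + a, 20 * t)" "active A k (10 * x + a + 2, 20 * t)"
        "a = -4 \<or> a = 2"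
      proof (cases "active A k (10 * x - 4, 20 * t) \<and> active A k (10 * x - 2, 20 * t)")
        case True
        then show ?thesis by (intro that[of "-4"]) auto
      next
        case False
        then show ?thesis using act by (intro that[of 2]) (auto simp: add.commute)
      qed
      then show ?thesis
        using good that by (intro spreads_block[OF Suc, of x t]) auto
    qed
    \<comment> \<open>The targets are the right pair of the left neighbour and the left pair of the
      right neighbour.\<close>
    have eq: "10 * (x - 1) + 2 = 10 * x + (-8)" "10 * (x - 1) + 4 = 10 * x + (-6)"
      "10 * (x + 1) - 4 = 10 * x + 6" "10 * (x + 1) - 2 = 10 * x + 8" "20 * (t + 1) = 20 * t + 20"
      by simp_all
    show "active A (Suc k) (x - 1, t + 1) \<and> active A (Suc k) (x + 1, t + 1)"
      unfolding active.simps fst_conv snd_conv eq using *[of 6] *[of 8] *[of "-6"] *[of "-8"] by simp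
  qed
qed

definition seed_box :: "vertex set" where
  "seed_box = {-40..40} \<times> {2..39} \<inter> vertices"

text \<open>The block of the level \<open>k + 1\<close> site \<open>(0, 2)\<close> begins in row 40
  of level \<open>k\<close>, so a good path of 38 steps has to lead from \<open>(0, 2)\<close> to
  each site of its left pair. The starting site is the same on every level, hence one box serves all
  levels.\<close>

lemma active_seed:
  assumes AB: "spreads B A" and A: "A (0, 2)" and good: "\<And>k v. v \<in> seed_box \<Longrightarrow> \<not> bad B k v"
  shows "active A k (0, 2)"
proof (induction k)
  case (Suc k)
  have "active A k (y, 40)" if y: "y = -4 \<or> y = -2" for y
  proof -
    define f where "f n = max (- int n) (y - 38 + int n)" for n
    have f: "lattice_path f 38"
      unfolding lattice_path_def f_def using y by (auto simp: max_def)
    have ends: "f 0 = 0" "f 38 = y" unfolding f_def using y by auto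
    have "active A k (f 38, 2 + int 38)"
    proof (rule spreads_path[OF spreads_active[OF AB] f])
      fix n :: nat assume n: "n < 38"
      have "(f n, 2 + int n) \<in> vertices"
        using n by (intro lattice_path_vertex[OF f]) (auto simp: ends)
      moreover have "-40 \<le> f n" "f n \<le> 40" using n y by (auto simp: f_def)
      ultimately show "\<not> bad B k (f n, 2 + int n)" using n by (intro good) (auto simp: seed_box_def)
    qed (use Suc in \<open>auto simp: ends\<close>)
    then show ?thesis by (simp add: ends)
  qed
  then show ?case by simp
qed (use A in simp)

text \<open>Each level multiplies times by 20, so activity at a fixed positive time on all levels
  gives activity at arbitrarily late times.\<close>

lemma active_base:
  assumes "active A k (x, t)"
  shows "\<exists>x'. A (x', 20 ^ k * t)"
  using assms
proof (induction k arbitrary: x t)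
  case (Suc k)
  then obtain x' where "active A k (x', 20 * t)" by auto
  from Suc.IH[OF this] show ?case by (simp add: mult_ac)
qed auto

section \<open>Density of bad sites\<close>

lemma block_vertices: "u \<in> block v \<Longrightarrow> u \<in> vertices"
  by (auto simp: block_def)

text \<open>The bound 380 counts 19 columns times 20 rows and ignores parity.\<close>

lemma
  shows finite_block: "finite (block v)" and card_block: "card (block v) \<le> 380"
proof -
  obtain x t where v: "v = (x, t)" by fastforce
  have sub: "block v \<subseteq> {10 * x - 9..10 * x + 9} \<times> {20 * t..20 * t + 19}"
    by (auto simp: block_def v)
  show "finite (block v)" by (rule finite_subset[OF sub]) simp
  have "card (block v) \<le> card ({10 * x - 9..10 * x + 9} \<times> {20 * t..20 * t + 19})"
    by (rule card_mono[OF _ sub]) simp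
  then show "card (block v) \<le> 380" by (simp add: card_cartesian_product)
qed

lemma block_disjoint:
  assumes "v \<in> vertices" "w \<in> vertices" "u \<in> block v" "u \<in> block w"
  shows "v = w"
proof -
  obtain x t x' t' j n where eq: "v = (x, t)" "w = (x', t')" "u = (j, n)" by fastforce
  have t: "t = t'" using assms by (simp add: block_def eq)
  have "\<bar>x - x'\<bar> < 2" using assms unfolding block_def eq by simp linarith
  moreover have "even (x - x')" using assms t by (simp add: eq)
  ultimately have "x = x'" by presburger
  with t show ?thesis by (simp add: eq)
qed

context prob_space
begin

text \<open>The additional set \<open>U\<close> is what makes the induction on \<open>S\<close> work: it collects the bad pairs already
  chosen in blocks that have been dealt with.\<close>

lemma prob_two_bad_in_blocks:
  fixes b :: "'a \<Rightarrow> vertex \<Rightarrow> bool"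
  assumes meas: "\<And>v. v \<in> vertices \<Longrightarrow> {\<omega> \<in> space M. b \<omega> v} \<in> events" and q: "0 \<le> q"
    and bound: "\<And>S. finite S \<Longrightarrow> S \<subseteq> vertices \<Longrightarrow> prob {\<omega> \<in> space M. \<forall>v\<in>S. b \<omega> v} \<le> q ^ card S"
    and S: "finite S" "S \<subseteq> vertices" and U: "finite U" "U \<subseteq> vertices" "\<And>v. v \<in> S \<Longrightarrow> block v \<inter> U = {}"
  shows "prob {\<omega> \<in> space M. (\<forall>v\<in>S. \<exists>u\<in>block v. \<exists>w\<in>block v. u \<noteq> w \<and> b \<omega> u \<and> b \<omega> w) \<and> (\<forall>v\<in>U. b \<omega> v)}
    \<le> ((380 * q)\<^sup>2) ^ card S * q ^ card U"
  using S U
proof (induction S arbitrary: U rule: finite_induct)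
  case empty
  with bound[of U] show ?case by simp
next
  case (insert x S)
  let ?E = "\<lambda>S U. {\<omega> \<in> space M. (\<forall>v\<in>S. \<exists>u\<in>block v. \<exists>w\<in>block v. u \<noteq> w \<and> b \<omega> u \<and> b \<omega> w) \<and> (\<forall>v\<in>U. b \<omega> v)}"
  let ?P = "{(u, w) \<in> block x \<times> block x. u \<noteq> w}"
  have ev: "?E S (insert u (insert w U)) \<in> events" if "u \<in> block x" "w \<in> block x" for u w
    using that insert.hyps(1) insert.prems(2,3)
    by (intro sets.sets_Collect sets.sets_Collect_finite_All sets.sets_Collect_finite_Ex meas finite_block)
      (auto dest: block_vertices)
  have finP: "finite ?P"
    by (rule finite_subset[of _ "block x \<times> block x"]) (auto simp: finite_block)
  have cardP: "card ?P \<le> 380\<^sup>2"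
  proof -
    have "card ?P \<le> card (block x \<times> block x)"
      by (rule card_mono) (auto simp: finite_block)
    also have "\<dots> \<le> 380\<^sup>2"
      unfolding card_cartesian_product power2_eq_square by (intro mult_mono card_block) auto
    finally show ?thesis .
  qed
  have "?E (insert x S) U \<subseteq> (\<Union>(u, w)\<in>?P. ?E S (insert u (insert w U)))"
    by auto
  then have "prob (?E (insert x S) U) \<le> prob (\<Union>(u, w)\<in>?P. ?E S (insert u (insert w U)))"
    using ev finP by (intro finite_measure_mono sets.finite_UN) auto
  also have "\<dots> \<le> (\<Sum>(u, w)\<in>?P. prob (?E S (insert u (insert w U))))"
    using ev finP unfolding case_prod_beta by (intro finite_measure_subadditive_finite) auto
  also have "\<dots> \<le> (\<Sum>(u, w)\<in>?P. ((380 * q)\<^sup>2) ^ card S * q ^ (card U + 2))"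
  proof (rule sum_mono)
    fix c assume "c \<in> ?P"
    then obtain u w where c: "c = (u, w)" and uw: "u \<in> block x" "w \<in> block x" "u \<noteq> w" by blast
    \<comment> \<open>The new pair avoids \<open>U\<close> and gains a factor
      \<open>q\<^sup>2\<close>; as blocks are disjoint, the enlarged \<open>U\<close> still avoids
      the blocks of \<open>S\<close>. The sum over at most \<open>380\<^sup>2\<close> ordered pairs
      then produces \<open>(380 * q)\<^sup>2\<close>.\<close>
    have "u \<notin> U" "w \<notin> U" using uw insert.prems(4)[of x] by auto
    then have card: "card (insert u (insert w U)) = card U + 2" using uw insert.prems by simp
    have "block v \<inter> insert u (insert w U) = {}" if "v \<in> S" for v
      using that uw insert.prems(1,4) insert.hyps(2) block_disjoint[of v x] by blast
    then have "prob (?E S (insert u (insert w U))) \<le> ((380 * q)\<^sup>2) ^ card S * q ^ card (insert u (insert w U))"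
      using uw insert.prems by (intro insert.IH) (auto dest: block_vertices)
    then show "(case c of (u, w) \<Rightarrow> prob (?E S (insert u (insert w U))))
        \<le> (case c of (u, w) \<Rightarrow> ((380 * q)\<^sup>2) ^ card S * q ^ (card U + 2))"
      unfolding card c prod.case .
  qed
  also have "\<dots> = real (card ?P) * (((380 * q)\<^sup>2) ^ card S * q ^ (card U + 2))"
    by (simp add: case_prod_beta)
  also have "\<dots> \<le> real (380\<^sup>2) * (((380 * q)\<^sup>2) ^ card S * q ^ (card U + 2))"
    using q cardP by (intro mult_right_mono) (simp_all only: of_nat_le_iff, simp)
  also have "\<dots> = ((380 * q)\<^sup>2) ^ card (insert x S) * q ^ card U"
    using insert.hyps by (simp add: power2_eq_square power_add)
  finally show ?case .
qed

lemma bad_measurable: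
  fixes B :: "'a \<Rightarrow> vertex \<Rightarrow> bool"
  assumes "\<And>v. v \<in> vertices \<Longrightarrow> {\<omega> \<in> space M. B \<omega> v} \<in> events" "v \<in> vertices"
  shows "{\<omega> \<in> space M. bad (B \<omega>) k v} \<in> events"
  using assms(2)
proof (induction k arbitrary: v)
  case (Suc k)
  have "{\<omega> \<in> space M. bad (B \<omega>) k u} \<in> events" if "u \<in> block v" for u
    using that by (intro Suc.IH) (rule block_vertices)
  then show ?case
    unfolding bad.simps
    by (intro sets.sets_Collect_finite_Ex sets.sets_Collect_conj sets.sets_Collect_const finite_block)
qed (use assms in simp)

text \<open>Bounding the joint probability over arbitrary finite sets replaces independence and
  passes from level to level. The density obeys the recursion from \<open>q\<close> to
  \<open>(380 * q)\<^sup>2\<close>, which at least halves any \<open>q\<close> below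
  \<open>1 / (2 * 380\<^sup>2)\<close>.\<close>

lemma prob_bad_le:
  fixes B :: "'a \<Rightarrow> vertex \<Rightarrow> bool"
  assumes meas: "\<And>v. v \<in> vertices \<Longrightarrow> {\<omega> \<in> space M. B \<omega> v} \<in> events" and p: "0 \<le> p" "p \<le> 1 / (2 * 380\<^sup>2)"
    and bound: "\<And>S. finite S \<Longrightarrow> S \<subseteq> vertices \<Longrightarrow> prob {\<omega> \<in> space M. \<forall>v\<in>S. B \<omega> v} \<le> p ^ card S"
    and S: "finite S" "S \<subseteq> vertices"
  shows "prob {\<omega> \<in> space M. \<forall>v\<in>S. bad (B \<omega>) k v} \<le> ((1 / 2) ^ Suc k / 380\<^sup>2) ^ card S"
  using S
proof (induction k arbitrary: S)
  case 0
  have "prob {\<omega> \<in> space M. \<forall>v\<in>S. bad (B \<omega>) 0 v} \<le> p ^ card S"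
    using bound 0 by simp
  also have "\<dots> \<le> ((1 / 2) ^ Suc 0 / 380\<^sup>2) ^ card S"
    using p by (intro power_mono) auto
  finally show ?case .
next
  case (Suc k)
  define q :: real where "q = (1 / 2) ^ Suc k / 380\<^sup>2"
  have "prob {\<omega> \<in> space M. \<forall>v\<in>S. bad (B \<omega>) (Suc k) v} \<le> ((380 * q)\<^sup>2) ^ card S"
    using prob_two_bad_in_blocks[where b = "\<lambda>\<omega>. bad (B \<omega>) k" and q = q and S = S and U = "{}"]
      bad_measurable[OF meas] Suc by (simp add: q_def)
  also have "\<dots> \<le> ((1 / 2) ^ Suc (Suc k) / 380\<^sup>2) ^ card S"
  proof (intro power_mono)
    have "(380 * q)\<^sup>2 = ((1 / 2) ^ Suc k) * ((1 / 2) ^ Suc k) / 380\<^sup>2"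
      by (simp add: q_def power2_eq_square)
    also have "\<dots> \<le> (1 / 2) * ((1 / 2) ^ Suc k) / 380\<^sup>2"
      by (intro divide_right_mono mult_right_mono) (auto simp: power_le_one)
    finally show "(380 * q)\<^sup>2 \<le> (1 / 2) ^ Suc (Suc k) / 380\<^sup>2" by simp
  qed simp
  finally show ?case .
qed

lemma finite_seed_box: "finite seed_box" and card_seed_box: "card seed_box \<le> 3078"
  and seed_box_subset: "seed_box \<subseteq> vertices"
proof -
  have sub: "seed_box \<subseteq> {-40..40} \<times> {2..39}" by (auto simp: seed_box_def)
  show "finite seed_box" by (rule finite_subset[OF sub]) simp
  have "card seed_box \<le> card ({-40..40::int} \<times> {2..39::int})"
    by (rule card_mono[OF _ sub]) simp
  then show "card seed_box \<le> 3078" by (simp add: card_cartesian_product)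
qed (auto simp: seed_box_def)

text \<open>A union bound over all levels and all sites of the box: the geometric series in
  \<open>k\<close> sums to 1, so the total failure probability is at most
  \<open>3078 / 380\<^sup>2\<close>, which is below 1.\<close>

lemma prob_all_levels_good:
  fixes B :: "'a \<Rightarrow> vertex \<Rightarrow> bool"
  assumes meas: "\<And>v. v \<in> vertices \<Longrightarrow> {\<omega> \<in> space M. B \<omega> v} \<in> events" and p: "0 \<le> p" "p \<le> 1 / (2 * 380\<^sup>2)"
    and bound: "\<And>S. finite S \<Longrightarrow> S \<subseteq> vertices \<Longrightarrow> prob {\<omega> \<in> space M. \<forall>v\<in>S. B \<omega> v} \<le> p ^ card S"
  shows "0 < prob {\<omega> \<in> space M. \<forall>k. \<forall>v\<in>seed_box. \<not> bad (B \<omega>) k v}"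
proof -
  define E where "E k = {\<omega> \<in> space M. \<exists>v\<in>seed_box. bad (B \<omega>) k v}" for k
  have E_eq: "E k = (\<Union>v\<in>seed_box. {\<omega> \<in> space M. bad (B \<omega>) k v})" for k
    by (auto simp: E_def)
  have ev: "{\<omega> \<in> space M. bad (B \<omega>) k v} \<in> events" if "v \<in> seed_box" for k v
    using that seed_box_subset by (intro bad_measurable meas) blast+
  have E_ev: "E k \<in> events" for k
    unfolding E_eq using ev finite_seed_box by auto
  have E_le: "prob (E k) \<le> 3078 / 380\<^sup>2 * (1 / 2) ^ Suc k" for k
  proof -
    have "prob (E k) \<le> (\<Sum>v\<in>seed_box. prob {\<omega> \<in> space M. bad (B \<omega>) k v})"
      unfolding E_eq using ev finite_seed_box by (intro finite_measure_subadditive_finite) auto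
    also have "\<dots> \<le> (\<Sum>v\<in>seed_box. (1 / 2) ^ Suc k / 380\<^sup>2)"
    proof (rule sum_mono)
      fix v assume "v \<in> seed_box"
      then show "prob {\<omega> \<in> space M. bad (B \<omega>) k v} \<le> (1 / 2) ^ Suc k / 380\<^sup>2"
        using prob_bad_le[OF meas p bound, of "{v}" k] seed_box_subset by auto
    qed
    also have "\<dots> = real (card seed_box) * ((1 / 2) ^ Suc k / 380\<^sup>2)" by simp
    also have "\<dots> \<le> 3078 * ((1 / 2) ^ Suc k / 380\<^sup>2)"
      using card_seed_box by (intro mult_right_mono) auto
    finally show ?thesis by simp
  qed
  have sums: "(\<lambda>k. 3078 / 380\<^sup>2 * (1 / 2) ^ Suc k) sums (3078 / 380\<^sup>2 * 1 :: real)"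
    by (intro sums_mult power_half_series)
  have summ: "summable (\<lambda>k. prob (E k))"
    by (rule summable_comparison_test'[OF sums_summable[OF sums], of 0])
      (use E_le measure_nonneg in auto)
  have "prob (\<Union>k. E k) \<le> (\<Sum>k. prob (E k))"
    using E_ev summ by (intro finite_measure_subadditive_countably) auto
  also have "\<dots> \<le> (\<Sum>k. 3078 / 380\<^sup>2 * (1 / 2) ^ Suc k)"
    by (intro suminf_le E_le summ sums_summable[OF sums])
  also have "\<dots> < 1" using sums_unique[OF sums] by simp
  finally have "prob (\<Union>k. E k) < 1" .
  moreover have "{\<omega> \<in> space M. \<forall>k. \<forall>v\<in>seed_box. \<not> bad (B \<omega>) k v} = space M - (\<Union>k. E k)"
    by (auto simp: E_def)
  ultimately show ?thesis
    using prob_compl[of "\<Union>k. E k"] E_ev by auto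
qed

end

section \<open>Walks with drift\<close>

text \<open>A walker who prefers the direction of \<open>c\<close> at branch points. Treating blocked vertices like branch
  points makes the law of the walk independent of \<open>\<epsilon>\<close>; blocked vertices are excluded separately.\<close>

definition move :: "int \<Rightarrow> arrows \<Rightarrow> int \<Rightarrow> int" where
  "move c a x = (case a of UpLeft \<Rightarrow> x - 1 | UpRight \<Rightarrow> x + 1 | _ \<Rightarrow> if x < c then x + 1 else x - 1)"

primrec walk :: "(vertex \<Rightarrow> arrows) \<Rightarrow> int \<Rightarrow> nat \<Rightarrow> int \<Rightarrow> int \<Rightarrow> int" where
  "walk \<omega> c 0 x t = x"
| "walk \<omega> c (Suc n) x t = walk \<omega> c n (move c (\<omega> (x, t)) x) (t + 1)"

lemma move_cases: "move c a x = x - 1 \<or> move c a x = x + 1"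
  by (auto simp: move_def split: arrows.split)

text \<open>The definition splits off the first step, as conditioning on the first arrow requires;
  following a trajectory forward in time needs the last step instead.\<close>

lemma walk_Suc: "walk \<omega> c (Suc n) x t = move c (\<omega> (walk \<omega> c n x t, t + int n)) (walk \<omega> c n x t)"
proof (induction n arbitrary: x t)
  case (Suc n)
  have "walk \<omega> c (Suc (Suc n)) x t = walk \<omega> c (Suc n) (move c (\<omega> (x, t)) x) (t + 1)" by simp
  also have "\<dots> = move c (\<omega> (walk \<omega> c (Suc n) x t, t + 1 + int n)) (walk \<omega> c (Suc n) x t)"
    by (subst Suc.IH) simp
  finally show ?case by (simp add: add_ac)
qed simp

lemma even_walk: "even (x + t) \<Longrightarrow> even (walk \<omega> c n x t + (t + int n))"
proof (induction n)
  case (Suc n)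
  then show ?case
    unfolding walk_Suc using move_cases[of c "\<omega> (walk \<omega> c n x t, t + int n)" "walk \<omega> c n x t"]
    by auto
qed simp

text \<open>The half-open time interval matters: the arrow at the endpoint is never read, and the
  continuation after one step does not read the row of the starting point, so it is independent of
  the first arrow.\<close>

lemma depends_on_walk:
  assumes "even (x + t)"
  shows "depends_on ({x - int n..x + int n} \<times> {t..<t + int n} \<inter> vertices) (\<lambda>\<omega>. P (walk \<omega> c n x t))"
proof -
  have "walk \<omega> c n x t = walk \<omega>' c n x t"
    if "\<And>v. v \<in> {x - int n..x + int n} \<times> {t..<t + int n} \<inter> vertices \<Longrightarrow> \<omega> v = \<omega>' v" for \<omega> \<omega>'
    using assms that
  proof (induction n arbitrary: x t)
    case (Suc n)
    define y where "y = move c (\<omega> (x, t)) x"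
    have \<omega>: "\<omega> (x, t) = \<omega>' (x, t)" by (rule Suc.prems(2)) (use Suc.prems(1) in auto)
    have y: "y = x - 1 \<or> y = x + 1" unfolding y_def by (rule move_cases)
    have "walk \<omega> c n y (t + 1) = walk \<omega>' c n y (t + 1)"
    proof (rule Suc.IH)
      show "even (y + (t + 1))" using y Suc.prems(1) by auto
      fix v assume "v \<in> {y - int n..y + int n} \<times> {t + 1..<t + 1 + int n} \<inter> vertices"
      then show "\<omega> v = \<omega>' v" using y by (intro Suc.prems(2)) auto
    qed
    then show ?case by (simp add: y_def \<omega>[symmetric])
  qed simp
  then show ?thesis unfolding depends_on_def by metis
qed

section \<open>Independence and marginals of the arrow field\<close>

lemma prob_space_arrow_measure: "prob_space (arrow_measure \<delta> \<epsilon>)"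
  unfolding arrow_measure_def by (intro prob_space_PiM) (rule prob_space_measure_pmf)

lemma arrow_measure_indep:
  fixes \<delta> \<epsilon> :: real
  defines "M \<equiv> arrow_measure \<delta> \<epsilon>"
  assumes "finite F" "F \<subseteq> vertices" "depends_on F Q" "finite G" "G \<subseteq> vertices" "depends_on G R" "F \<inter> G = {}"
  shows "measure M {\<omega> \<in> space M. Q \<omega> \<and> R \<omega>}
    = measure M {\<omega> \<in> space M. Q \<omega>} * measure M {\<omega> \<in> space M. R \<omega>}"
proof -
  have "(0, 0) \<in> vertices" by simp
  then have "vertices \<noteq> {}" by blast
  with depends_on_indep[of F vertices Q G R "arrow_pmf \<delta> \<epsilon>"] assms show ?thesis
    by (simp add: arrow_measure_def)
qed

lemma arrow_measure_measurable:
  assumes "finite F" "F \<subseteq> vertices" "depends_on F Q"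
  shows "{\<omega> \<in> space (arrow_measure \<delta> \<epsilon>). Q \<omega>} \<in> sets (arrow_measure \<delta> \<epsilon>)"
  unfolding arrow_measure_def by (rule depends_on_measurable[OF assms])

lemma arrow_measure_single:
  assumes "\<delta> \<in> {0..1}" "\<epsilon> \<in> {0..1}" "v \<in> vertices"
  shows "measure (arrow_measure \<delta> \<epsilon>) {\<omega> \<in> space (arrow_measure \<delta> \<epsilon>). \<omega> v \<in> S} = (\<Sum>a\<in>S. arrow_prob \<delta> \<epsilon> a)"
proof -
  interpret product_prob_space "\<lambda>_. measure_pmf (arrow_pmf \<delta> \<epsilon>)" vertices
    by (rule product_prob_space_pmf)
  have "emeasure (arrow_measure \<delta> \<epsilon>) {\<omega> \<in> space (arrow_measure \<delta> \<epsilon>). \<omega> v \<in> S} = emeasure (arrow_pmf \<delta> \<epsilon>) S"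
    unfolding arrow_measure_def using assms by (intro emeasure_PiM_Collect_single) auto
  then have "measure (arrow_measure \<delta> \<epsilon>) {\<omega> \<in> space (arrow_measure \<delta> \<epsilon>). \<omega> v \<in> S} = measure (arrow_pmf \<delta> \<epsilon>) S"
    by (simp add: measure_def)
  also have "\<dots> = (\<Sum>a\<in>S. arrow_prob \<delta> \<epsilon> a)"
    by (simp add: measure_measure_pmf_finite pmf_arrow_pmf[OF assms(1,2)])
  finally show ?thesis .
qed

text \<open>Markov's inequality for a Lyapunov function \<open>h\<close> with geometric drift. The
  induction conditions on the first arrow and bounds probabilities directly, without expectations of
  \<open>h\<close>. Writing the additive error as \<open>C * (1 - \<rho>)\<close> makes the iterated
  bound telescope to \<open>C * (1 - \<rho> ^ n)\<close>.\<close>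

lemma walk_tail:
  fixes \<delta> \<epsilon> :: real and h :: "int \<Rightarrow> real"
  defines "M \<equiv> arrow_measure \<delta> \<epsilon>"
  assumes \<delta>: "\<delta> \<in> {0..1}" and \<epsilon>: "\<epsilon> \<in> {0..1}" and m: "0 < m" and h: "\<And>x. 0 \<le> h x" "\<And>x. x \<in> S \<Longrightarrow> m \<le> h x"
    and drift1: "\<And>x. x < c \<Longrightarrow> (1 + \<delta>) / 2 * h (x + 1) + (1 - \<delta>) / 2 * h (x - 1) \<le> \<rho> * h x + C * (1 - \<rho>)"
    and drift2: "\<And>x. c \<le> x \<Longrightarrow> (1 - \<delta>) / 2 * h (x + 1) + (1 + \<delta>) / 2 * h (x - 1) \<le> \<rho> * h x + C * (1 - \<rho>)"
    and \<rho>: "0 \<le> \<rho>" and x: "even (x + t)"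
  shows "measure M {\<omega> \<in> space M. walk \<omega> c n x t \<in> S} \<le> (\<rho> ^ n * h x + C * (1 - \<rho> ^ n)) / m"
  using x
proof (induction n arbitrary: x t)
  interpret prob_space M unfolding M_def by (rule prob_space_arrow_measure)
  case 0
  show ?case
  proof (cases "x \<in> S")
    case True
    then have "1 \<le> h x / m" using h m by simp
    moreover have "prob {\<omega> \<in> space M. walk \<omega> c 0 x t \<in> S} \<le> 1" by simp
    ultimately show ?thesis by (auto intro: order_trans[OF prob_le_1])
  qed (use h(1)[of x] m in simp)
next
  interpret prob_space M unfolding M_def by (rule prob_space_arrow_measure)
  case (Suc n)
  define U where "U = {a. move c a x = x + 1}"
  have v: "(x, t) \<in> vertices" using Suc.prems by simp
  have dep1: "depends_on {(x, t)} (\<lambda>\<omega>. \<omega> (x, t) \<in> W)" for W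
    by (rule depends_onI) auto
  have step: "prob {\<omega> \<in> space M. \<omega> (x, t) \<in> W \<and> walk \<omega> c n y (t + 1) \<in> S}
      \<le> (\<Sum>a\<in>W. arrow_prob \<delta> \<epsilon> a) * ((\<rho> ^ n * h y + C * (1 - \<rho> ^ n)) / m)"
    if y: "y = x - 1 \<or> y = x + 1" for y W
  proof -
    have e: "even (y + (t + 1))" using y Suc.prems by auto
    have "prob {\<omega> \<in> space M. \<omega> (x, t) \<in> W \<and> walk \<omega> c n y (t + 1) \<in> S}
        = prob {\<omega> \<in> space M. \<omega> (x, t) \<in> W} * prob {\<omega> \<in> space M. walk \<omega> c n y (t + 1) \<in> S}"
      unfolding M_def by (rule arrow_measure_indep[OF _ _ dep1 _ _ depends_on_walk[OF e]]) (use v in auto)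
    also have "prob {\<omega> \<in> space M. \<omega> (x, t) \<in> W} = (\<Sum>a\<in>W. arrow_prob \<delta> \<epsilon> a)"
      unfolding M_def by (rule arrow_measure_single[OF \<delta> \<epsilon> v])
    also have "\<dots> * prob {\<omega> \<in> space M. walk \<omega> c n y (t + 1) \<in> S} \<le> \<dots> * ((\<rho> ^ n * h y + C * (1 - \<rho> ^ n)) / m)"
    proof (rule mult_left_mono[OF Suc.IH[OF e]])
      have "0 \<le> arrow_prob \<delta> \<epsilon> a" for a using \<delta> \<epsilon> by (cases a) auto
      then show "0 \<le> (\<Sum>a\<in>W. arrow_prob \<delta> \<epsilon> a)" by (rule sum_nonneg)
    qed
    finally show ?thesis .
  qed
  have meas: "{\<omega> \<in> space M. \<omega> (x, t) \<in> W \<and> walk \<omega> c n y (t + 1) \<in> S} \<in> events" if y: "y = x - 1 \<or> y = x + 1" for y W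
  proof -
    have e: "even (y + (t + 1))" using y Suc.prems by auto
    show ?thesis unfolding M_def
      by (rule arrow_measure_measurable[OF _ _ depends_on_conj[OF dep1 depends_on_walk[OF e]]]) (use v in auto)
  qed
  have "{\<omega> \<in> space M. walk \<omega> c (Suc n) x t \<in> S}
      = {\<omega> \<in> space M. \<omega> (x, t) \<in> U \<and> walk \<omega> c n (x + 1) (t + 1) \<in> S}
      \<union> {\<omega> \<in> space M. \<omega> (x, t) \<in> - U \<and> walk \<omega> c n (x - 1) (t + 1) \<in> S}" (is "_ = ?A \<union> ?B")
  proof -
    have "walk \<omega> c (Suc n) x t \<in> S \<longleftrightarrow> \<omega> (x, t) \<in> U \<and> walk \<omega> c n (x + 1) (t + 1) \<in> S
        \<or> \<omega> (x, t) \<in> - U \<and> walk \<omega> c n (x - 1) (t + 1) \<in> S" for \<omega>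
      using move_cases[of c "\<omega> (x, t)" x] by (cases "\<omega> (x, t) \<in> U") (auto simp: U_def)
    then show ?thesis by blast
  qed
  then have "prob {\<omega> \<in> space M. walk \<omega> c (Suc n) x t \<in> S} \<le> prob ?A + prob ?B"
    using measure_Un_le[OF meas[of "x + 1" U] meas[of "x - 1" "- U"]] by simp
  also have "\<dots> \<le> (\<Sum>a\<in>U. arrow_prob \<delta> \<epsilon> a) * ((\<rho> ^ n * h (x + 1) + C * (1 - \<rho> ^ n)) / m)
      + (\<Sum>a\<in>-U. arrow_prob \<delta> \<epsilon> a) * ((\<rho> ^ n * h (x - 1) + C * (1 - \<rho> ^ n)) / m)"
    by (intro add_mono step) auto
  also have "\<dots> = (\<rho> ^ n * ((\<Sum>a\<in>U. arrow_prob \<delta> \<epsilon> a) * h (x + 1) + (\<Sum>a\<in>-U. arrow_prob \<delta> \<epsilon> a) * h (x - 1))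
      + ((\<Sum>a\<in>U. arrow_prob \<delta> \<epsilon> a) + (\<Sum>a\<in>-U. arrow_prob \<delta> \<epsilon> a)) * (C * (1 - \<rho> ^ n))) / m"
    using m by (simp add: field_simps)
  \<comment> \<open>Branch and blocked configurations move the walk alike and have total mass
    \<delta>, so \<epsilon> cancels.\<close>
  also have "(\<Sum>a\<in>U. arrow_prob \<delta> \<epsilon> a) = (if x < c then (1 + \<delta>) / 2 else (1 - \<delta>) / 2)"
  proof -
    have "U = (if x < c then {UpRight, Branch, Blocked} else {UpRight})"
      using UNIV_arrows by (auto simp: U_def move_def split: arrows.splits)
    then show ?thesis by (simp add: field_simps)
  qed
  also have "(\<Sum>a\<in>-U. arrow_prob \<delta> \<epsilon> a) = (if x < c then (1 - \<delta>) / 2 else (1 + \<delta>) / 2)"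
  proof -
    have "-U = (if x < c then {UpLeft} else {UpLeft, Branch, Blocked})"
      using UNIV_arrows by (auto simp: U_def move_def split: arrows.splits)
    then show ?thesis by (simp add: field_simps)
  qed
  also have "(if x < c then (1 + \<delta>) / 2 else (1 - \<delta>) / 2) + (if x < c then (1 - \<delta>) / 2 else (1 + \<delta>) / 2) = 1"
    by (simp add: field_simps)
  also have "(\<rho> ^ n * ((if x < c then (1 + \<delta>) / 2 else (1 - \<delta>) / 2) * h (x + 1)
        + (if x < c then (1 - \<delta>) / 2 else (1 + \<delta>) / 2) * h (x - 1)) + 1 * (C * (1 - \<rho> ^ n))) / m
      \<le> (\<rho> ^ n * (\<rho> * h x + C * (1 - \<rho>)) + C * (1 - \<rho> ^ n)) / m"
    unfolding mult_1 using drift1[of x] drift2[of x] \<rho> m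
    by (intro divide_right_mono add_right_mono mult_left_mono) (auto split: if_splits)
  also have "\<dots> = (\<rho> ^ Suc n * h x + C * (1 - \<rho> ^ Suc n)) / m"
    by (simp add: algebra_simps)
  finally show ?case .
qed

text \<open>On the positive side base \<open>1 + \<delta>\<close> gives the exact factor \<open>1 /
  2 + (1 - \<delta>) * (1 + \<delta>) / 2 = 1 - \<delta>\<^sup>2 / 2\<close>. On the other side
  \<open>nat\<close> flattens \<open>h\<close> to 1, so values next to such points are at most 2
  whatever the direction of the drift.\<close>

lemma drift_geometric:
  fixes \<delta> :: real
  assumes "0 < \<delta>" "\<delta> \<le> 1" and h: "h = (\<lambda>j. (1 + \<delta>) ^ nat j)"
  shows "0 < j \<Longrightarrow> (1 + \<delta>) / 2 * h (j - 1) + (1 - \<delta>) / 2 * h (j + 1) \<le> (1 - \<delta>\<^sup>2 / 2) * h j + 2"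
    and "j \<le> 0 \<Longrightarrow> 0 \<le> p \<Longrightarrow> 0 \<le> q \<Longrightarrow> p + q = 1 \<Longrightarrow>
      p * h (j - 1) + q * h (j + 1) \<le> (1 - \<delta>\<^sup>2 / 2) * h j + 2"
proof -
  have sq: "\<delta>\<^sup>2 \<le> 1" using assms by (simp add: power_le_one)
  show "(1 + \<delta>) / 2 * h (j - 1) + (1 - \<delta>) / 2 * h (j + 1) \<le> (1 - \<delta>\<^sup>2 / 2) * h j + 2" if "0 < j"
  proof -
    define i where "i = nat (j - 1)"
    have "nat j = Suc i" "nat (j + 1) = Suc (Suc i)" using that by (auto simp: i_def)
    then have "(1 + \<delta>) / 2 * h (j - 1) + (1 - \<delta>) / 2 * h (j + 1) = (1 - \<delta>\<^sup>2 / 2) * h j"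
      unfolding h i_def[symmetric] by (simp add: field_simps power2_eq_square)
    then show ?thesis by simp
  qed
  show "p * h (j - 1) + q * h (j + 1) \<le> (1 - \<delta>\<^sup>2 / 2) * h j + 2"
    if "j \<le> 0" and pq: "0 \<le> p" "0 \<le> q" "p + q = 1"
  proof -
    have "h a \<le> 2" if "a \<le> 1" for a
    proof -
      have "nat a \<le> 1" using that by simp
      then have "(1 + \<delta>) ^ nat a \<le> (1 + \<delta>) ^ 1" using assms by (intro power_increasing) auto
      also have "\<dots> \<le> 2" using assms by simp
      finally show ?thesis by (simp add: h)
    qed
    then have "p * h (j - 1) + q * h (j + 1) \<le> p * 2 + q * 2"
      using that by (intro add_mono mult_left_mono) auto
    moreover have "0 \<le> (1 - \<delta>\<^sup>2 / 2) * h j" using sq assms by (simp add: h)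
    ultimately show ?thesis using pq(3) by (simp add: algebra_simps)
  qed
qed

lemma walk_tails:
  fixes \<delta> \<epsilon> :: real
  defines "M \<equiv> arrow_measure \<delta> \<epsilon>"
  assumes \<delta>: "0 < \<delta>" "\<delta> \<le> 1" and \<epsilon>: "\<epsilon> \<in> {0..1}" and x: "even (x + t)"
  shows "measure M {\<omega> \<in> space M. walk \<omega> c n x t \<le> c - int m}
      \<le> ((1 - \<delta>\<^sup>2 / 2) ^ n * (1 + \<delta>) ^ nat (c - x) + 4 / \<delta>\<^sup>2) / (1 + \<delta>) ^ m" (is ?left)
    and "measure M {\<omega> \<in> space M. c + int m \<le> walk \<omega> c n x t}
      \<le> ((1 - \<delta>\<^sup>2 / 2) ^ n * (1 + \<delta>) ^ nat (x - c) + 4 / \<delta>\<^sup>2) / (1 + \<delta>) ^ m" (is ?right)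
proof -
  define h :: "int \<Rightarrow> real" where "h = (\<lambda>j. (1 + \<delta>) ^ nat j)"
  have \<rho>: "0 \<le> 1 - \<delta>\<^sup>2 / 2" "1 - \<delta>\<^sup>2 / 2 \<le> 1"
    using \<delta> power_le_one[of \<delta> 2] by auto
  \<comment> \<open>The constant \<open>4 / \<delta>\<^sup>2\<close> is the \<open>C\<close> for
    which \<open>C * (1 - \<rho>)\<close> is the additive error 2 of the drift bound.\<close>
  have C: "4 / \<delta>\<^sup>2 * (1 - (1 - \<delta>\<^sup>2 / 2)) = 2" using \<delta> by simp
  have pq: "0 \<le> (1 - \<delta>) / 2" "0 \<le> (1 + \<delta>) / 2" "(1 - \<delta>) / 2 + (1 + \<delta>) / 2 = 1" "(1 + \<delta>) / 2 + (1 - \<delta>) / 2 = 1"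
    using \<delta> by (auto simp: field_simps)
  note drift = drift_geometric(1)[OF \<delta> h_def] drift_geometric(2)[OF \<delta> h_def _ pq(1,2,3)]
    drift_geometric(2)[OF \<delta> h_def _ pq(2,1,4)]
  have le: "(a + 4 / \<delta>\<^sup>2 * (1 - (1 - \<delta>\<^sup>2 / 2) ^ n)) / (1 + \<delta>) ^ m \<le> (a + 4 / \<delta>\<^sup>2) / (1 + \<delta>) ^ m" for a
    using \<rho> \<delta> by (intro divide_right_mono add_left_mono mult_left_le) auto
  have pos: "0 < (1 + \<delta>) ^ m" using \<delta> by simp
  have big: "(1 + \<delta>) ^ m \<le> h j" if "int m \<le> j" for j
    unfolding h_def using that \<delta> by (intro power_increasing) auto
  have h0: "0 \<le> h j" for j unfolding h_def using \<delta> by simp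
  have "measure M {\<omega> \<in> space M. walk \<omega> c n x t \<in> {y. y \<le> c - int m}}
      \<le> ((1 - \<delta>\<^sup>2 / 2) ^ n * h (c - x) + 4 / \<delta>\<^sup>2 * (1 - (1 - \<delta>\<^sup>2 / 2) ^ n)) / (1 + \<delta>) ^ m"
    unfolding M_def
  proof (rule walk_tail[where h = "\<lambda>y. h (c - y)", OF _ \<epsilon> pos h0 _ _ _ \<rho>(1) x])
    fix y
    show "(1 + \<delta>) / 2 * h (c - (y + 1)) + (1 - \<delta>) / 2 * h (c - (y - 1))
      \<le> (1 - \<delta>\<^sup>2 / 2) * h (c - y) + 4 / \<delta>\<^sup>2 * (1 - (1 - \<delta>\<^sup>2 / 2))" if "y < c"
      using drift(1)[of "c - y"] that unfolding C by (simp add: algebra_simps)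
    show "(1 - \<delta>) / 2 * h (c - (y + 1)) + (1 + \<delta>) / 2 * h (c - (y - 1))
      \<le> (1 - \<delta>\<^sup>2 / 2) * h (c - y) + 4 / \<delta>\<^sup>2 * (1 - (1 - \<delta>\<^sup>2 / 2))" if "c \<le> y"
      using drift(2)[of "c - y"] that unfolding C by (simp add: algebra_simps)
  qed (use \<delta> in \<open>auto intro: big\<close>)
  with le[of "(1 - \<delta>\<^sup>2 / 2) ^ n * h (c - x)"] show ?left by (simp add: h_def)
  have "measure M {\<omega> \<in> space M. walk \<omega> c n x t \<in> {y. c + int m \<le> y}}
      \<le> ((1 - \<delta>\<^sup>2 / 2) ^ n * h (x - c) + 4 / \<delta>\<^sup>2 * (1 - (1 - \<delta>\<^sup>2 / 2) ^ n)) / (1 + \<delta>) ^ m"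
    unfolding M_def
  proof (rule walk_tail[where h = "\<lambda>y. h (y - c)", OF _ \<epsilon> pos h0 _ _ _ \<rho>(1) x])
    fix y
    show "(1 + \<delta>) / 2 * h (y + 1 - c) + (1 - \<delta>) / 2 * h (y - 1 - c)
      \<le> (1 - \<delta>\<^sup>2 / 2) * h (y - c) + 4 / \<delta>\<^sup>2 * (1 - (1 - \<delta>\<^sup>2 / 2))" if "y < c"
      using drift(2)[of "y - c"] that unfolding C by (simp add: algebra_simps)
    \<comment> \<open>At \<open>y = c\<close> the walk already prefers to step left, and this point
      lies on the flat part of \<open>h\<close>; it needs the third drift bound.\<close>
    show "(1 - \<delta>) / 2 * h (y + 1 - c) + (1 + \<delta>) / 2 * h (y - 1 - c)
      \<le> (1 - \<delta>\<^sup>2 / 2) * h (y - c) + 4 / \<delta>\<^sup>2 * (1 - (1 - \<delta>\<^sup>2 / 2))" if "c \<le> y"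
      using drift(1,3)[of "y - c"] that unfolding C by (cases "y = c") (simp_all add: algebra_simps)
  qed (use \<delta> in \<open>auto intro: big\<close>)
  with le[of "(1 - \<delta>\<^sup>2 / 2) ^ n * h (x - c)"] show ?right by (simp add: h_def)
qed

section \<open>Space-time blocks\<close>

text \<open>Space-time blocks of width \<open>8r\<close> and height \<open>T\<close>. Times are shifted by \<open>2T\<close> so that the origin lies in
  the block \<open>(0, 2)\<close>, which is the starting site of \<open>active_seed\<close> on every level. Walks started
  within distance \<open>2r\<close> of the centre line aim at points at distance \<open>3r\<close> from it: reaching them up to
  an error \<open>r\<close> gives entry to the next block without ever leaving the current region,
  so that the regions can be disjoint.\<close>

definition region :: "nat \<Rightarrow> nat \<Rightarrow> vertex \<Rightarrow> vertex set" where
  "region r T = (\<lambda>(j, n). {(x, t) \<in> vertices. \<bar>x - 4 * int r * j\<bar> < 4 * int r \<and>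
    int T * (n - 2) \<le> t \<and> t < int T * (n - 2) + int T})"

definition misses :: "nat \<Rightarrow> nat \<Rightarrow> (vertex \<Rightarrow> arrows) \<Rightarrow> int \<Rightarrow> int \<Rightarrow> int \<Rightarrow> int \<Rightarrow> bool" where
  "misses r T \<omega> z c x t \<longleftrightarrow> (\<exists>n\<le>T. 4 * int r \<le> \<bar>walk \<omega> c n x t - z\<bar>) \<or> int r < \<bar>walk \<omega> c T x t - c\<bar>"

lemma misses_inside:
  "\<not> misses r T \<omega> z c x t \<Longrightarrow> n \<le> T \<Longrightarrow> \<bar>walk \<omega> c n x t - z\<bar> < 4 * int r"
  unfolding misses_def by (meson not_le)

text \<open>The two causes of failure are kept apart: missing walks become rare for large
  \<open>r\<close>, uniformly in \<epsilon>, and blocked vertices become rare for small \<epsilon>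
  once \<open>r\<close> is fixed.\<close>

definition bad_block :: "nat \<Rightarrow> nat \<Rightarrow> (vertex \<Rightarrow> arrows) \<Rightarrow> vertex \<Rightarrow> bool" where
  "bad_block r T \<omega> = (\<lambda>(j, n). let z = 4 * int r * j; t = int T * (n - 2) in
    (\<exists>x\<in>{z - 2 * int r..z + 2 * int r}. \<exists>c\<in>{z - 3 * int r, z + 3 * int r}.
      even (x + t) \<and> misses r T \<omega> z c x t) \<or> (\<exists>v\<in>region r T (j, n). \<omega> v = Blocked))"

lemma bad_block_iff:
  assumes "z = 4 * int r * j" "t = int T * (n - 2)"
  shows "bad_block r T \<omega> (j, n) \<longleftrightarrow>
    (\<exists>x c. \<bar>x - z\<bar> \<le> 2 * int r \<and> even (x + t) \<and> (c = z - 3 * int r \<or> c = z + 3 * int r) \<and> misses r T \<omega> z c x t)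
    \<or> (\<exists>v\<in>region r T (j, n). \<omega> v = Blocked)"
proof -
  have "x \<in> {z - 2 * int r..z + 2 * int r} \<longleftrightarrow> \<bar>x - z\<bar> \<le> 2 * int r" for x by auto
  then show ?thesis
    unfolding bad_block_def prod.case Let_def assms[symmetric] by blast
qed

lemma region_vertices: "region r T v \<subseteq> vertices"
  by (auto simp: region_def)

lemma
  shows finite_region: "finite (region r T v)" and card_region: "card (region r T v) \<le> 8 * r * T"
proof -
  obtain j n where v: "v = (j, n)" by fastforce
  let ?R = "{4 * int r * j - 4 * int r<..<4 * int r * j + 4 * int r} \<times> {int T * (n - 2)..<int T * (n - 2) + int T}"
  have sub: "region r T v \<subseteq> ?R"
    by (auto simp: region_def v)
  show "finite (region r T v)" by (rule finite_subset[OF sub]) simp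
  have "card (region r T v) \<le> card ?R"
    by (rule card_mono[OF _ sub]) simp
  also have "\<dots> \<le> 8 * r * T"
    by (simp add: card_cartesian_product nat_le_iff)
  finally show "card (region r T v) \<le> 8 * r * T" .
qed

lemma int_le_of_slab: "int T * a \<le> t \<Longrightarrow> t < int T * b + int T \<Longrightarrow> a \<le> b"
proof (rule ccontr)
  assume *: "int T * a \<le> t" "t < int T * b + int T" "\<not> a \<le> b"
  then have "int T * (b + 1) \<le> int T * a" by (intro mult_left_mono) auto
  with * show False by (simp add: algebra_simps)
qed

lemma region_disjoint:
  assumes "v \<in> vertices" "w \<in> vertices" "v \<noteq> w"
  shows "region r T v \<inter> region r T w = {}"
proof (rule ccontr)
  obtain j n j' n' where eq: "v = (j, n)" "w = (j', n')" by fastforce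
  assume "region r T v \<inter> region r T w \<noteq> {}"
  then obtain x t where in_v: "(x, t) \<in> region r T (j, n)" and in_w: "(x, t) \<in> region r T (j', n')"
    by (auto simp: eq)
  have n: "n = n'"
    using int_le_of_slab[of T "n - 2" t "n' - 2"] int_le_of_slab[of T "n' - 2" t "n - 2"] in_v in_w
    by (auto simp: region_def)
  have "4 * int r * \<bar>j - j'\<bar> = \<bar>4 * int r * j - 4 * int r * j'\<bar>"
    by (simp add: abs_mult right_diff_distrib[symmetric])
  also have "\<dots> < 4 * int r * 2"
    using in_v in_w by (auto simp: region_def)
  finally have "\<bar>j - j'\<bar> < 2"
    by (rule mult_left_less_imp_less) simp
  moreover have "even (j - j')" using assms n by (simp add: eq)
  ultimately have "j = j'" by presburger
  with n assms(3) show False by (simp add: eq)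
qed

lemma walk_cong_inside:
  assumes agree: "\<And>v. v \<in> region r T (j, k) \<Longrightarrow> \<omega> v = \<omega>' v"
    and inside: "\<And>i. i < n \<Longrightarrow> \<bar>walk \<omega> c i x (int T * (k - 2)) - 4 * int r * j\<bar> < 4 * int r"
    and "n \<le> T" "even (x + int T * (k - 2))"
  shows "walk \<omega>' c n x (int T * (k - 2)) = walk \<omega> c n x (int T * (k - 2))"
  using inside \<open>n \<le> T\<close>
proof (induction n)
  case (Suc n)
  let ?t = "int T * (k - 2)"
  have eq: "walk \<omega>' c n x ?t = walk \<omega> c n x ?t"
    using Suc.prems by (intro Suc.IH) auto
  have "\<omega> (walk \<omega> c n x ?t, ?t + int n) = \<omega>' (walk \<omega> c n x ?t, ?t + int n)"
    using Suc.prems(1)[of n] Suc.prems(2) even_walk[OF assms(4), of \<omega> c n]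
    by (intro agree) (auto simp: region_def)
  then show ?case unfolding walk_Suc eq by simp
qed simp

text \<open>Walks may leave the region, but whether they miss is decided inside it: a walk that does
  not miss stays inside, reads only arrows of the region, and is therefore the same walk in every
  configuration agreeing there.\<close>

lemma depends_on_bad_block: "depends_on (region r T v) (\<lambda>\<omega>. bad_block r T \<omega> v)"
proof (rule depends_onI)
  obtain j k where v: "v = (j, k)" by fastforce
  fix \<omega> \<omega>' :: "vertex \<Rightarrow> arrows"
  assume agree: "\<And>u. u \<in> region r T v \<Longrightarrow> \<omega> u = \<omega>' u" and bad: "bad_block r T \<omega> v"
  define z where "z = 4 * int r * j"
  define t where "t = int T * (k - 2)"
  show "bad_block r T \<omega>' v"
  proof (cases "\<exists>u\<in>region r T v. \<omega> u = Blocked")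
    case True
    with agree show ?thesis unfolding v bad_block_iff[OF refl refl] by metis
  next
    case False
    with bad obtain x c where xc: "\<bar>x - z\<bar> \<le> 2 * int r" "c = z - 3 * int r \<or> c = z + 3 * int r"
      "even (x + t)" "misses r T \<omega> z c x t"
      unfolding v bad_block_iff[OF z_def t_def] by blast
    have "misses r T \<omega>' z c x t"
    proof (rule ccontr)
      assume *: "\<not> misses r T \<omega>' z c x t"
      have "walk \<omega> c n x t = walk \<omega>' c n x t" if "n \<le> T" for n
        unfolding t_def
      proof (rule walk_cong_inside[OF _ _ that xc(3)[unfolded t_def]])
        show "\<omega>' u = \<omega> u" if "u \<in> region r T (j, k)" for u
          using agree that by (simp add: v)
        show "\<bar>walk \<omega>' c i x (int T * (k - 2)) - 4 * int r * j\<bar> < 4 * int r" if "i < n" for i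
          using misses_inside[OF *, of i] that \<open>n \<le> T\<close> unfolding z_def t_def by simp
      qed
      then have "misses r T \<omega>' z c x t = misses r T \<omega> z c x t"
        unfolding misses_def by auto
      with * xc(4) show False by simp
    qed
    with xc show ?thesis unfolding v bad_block_iff[OF z_def t_def] by blast
  qed
qed

section \<open>Propagation of reachability from block to block\<close>

definition reach :: "(vertex \<Rightarrow> arrows) \<Rightarrow> vertex \<Rightarrow> bool" where
  "reach \<omega> = (has_arrow \<omega>)\<^sup>*\<^sup>* (0, 0)"

definition reach_block :: "nat \<Rightarrow> nat \<Rightarrow> (vertex \<Rightarrow> arrows) \<Rightarrow> vertex \<Rightarrow> bool" where
  "reach_block r T \<omega> = (\<lambda>(j, n). \<exists>x. \<bar>x - 4 * int r * j\<bar> \<le> 2 * int r \<and> even (x + int T * (n - 2)) \<and>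
    reach \<omega> (x, int T * (n - 2)))"

lemma reach_walk:
  assumes "reach \<omega> (x, t)" "even (x + t)" and "\<And>i. i < n \<Longrightarrow> \<omega> (walk \<omega> c i x t, t + int i) \<noteq> Blocked"
  shows "reach \<omega> (walk \<omega> c n x t, t + int n)"
  using assms(3)
proof (induction n)
  case (Suc n)
  let ?v = "(walk \<omega> c n x t, t + int n)"
  have "has_arrow \<omega> ?v (walk \<omega> c (Suc n) x t, t + int (Suc n))"
    unfolding walk_Suc has_arrow_def using Suc.prems[of n] even_walk[OF assms(2), of \<omega> c n]
    by (cases "\<omega> ?v") (auto simp: move_def)
  moreover have "reach \<omega> ?v" using Suc by simp
  ultimately show ?case unfolding reach_def by (rule rtranclp.rtrancl_into_rtrancl[rotated])
qed (use assms in simp)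

lemma spreads_reach_block: "spreads (bad_block r T \<omega>) (reach_block r T \<omega>)"
  unfolding spreads_def
proof (intro allI impI)
  fix j k :: int
  assume good: "\<not> bad_block r T \<omega> (j, k)" and A: "reach_block r T \<omega> (j, k)"
  define z where "z = 4 * int r * j"
  define t where "t = int T * (k - 2)"
  obtain x where x: "\<bar>x - z\<bar> \<le> 2 * int r" "even (x + t)" "reach \<omega> (x, t)"
    using A unfolding reach_block_def prod.case z_def[symmetric] t_def[symmetric] by blast
  note good' = good[unfolded bad_block_iff[OF z_def t_def]]
  have final: "\<bar>walk \<omega> c T x t - c\<bar> \<le> int r \<and> reach \<omega> (walk \<omega> c T x t, t + int T) \<and> even (walk \<omega> c T x t + (t + int T))"
    if c: "c = z - 3 * int r \<or> c = z + 3 * int r" for c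
  proof -
    have hit: "\<not> misses r T \<omega> z c x t"
      using good' x(1,2) c by blast
    have "\<omega> (walk \<omega> c i x t, t + int i) \<noteq> Blocked" if "i < T" for i
    proof -
      have "(walk \<omega> c i x t, t + int i) \<in> region r T (j, k)"
      proof -
        have "\<bar>walk \<omega> c i x t - z\<bar> < 4 * int r"
          using misses_inside[OF hit] that by simp
        with that even_walk[OF x(2), of \<omega> c i] show ?thesis
          unfolding region_def prod.case z_def[symmetric] t_def[symmetric] by simp
      qed
      with good' show ?thesis by blast
    qed
    then have "reach \<omega> (walk \<omega> c T x t, t + int T)"
      by (intro reach_walk x) auto
    with hit even_walk[OF x(2)] show ?thesis by (auto simp: misses_def)
  qed
  have t: "int T * (k + 1 - 2) = t + int T" by (simp add: t_def algebra_simps)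
  have z: "4 * int r * (j - 1) = z - 4 * int r" "4 * int r * (j + 1) = z + 4 * int r"
    by (simp_all add: z_def algebra_simps)
  \<comment> \<open>The next centres are at distance \<open>4 * r\<close>, so an endpoint within
    \<open>r\<close> of the aim at distance \<open>3 * r\<close> lies within \<open>2 * r\<close> of
    the next centre.\<close>
  show "reach_block r T \<omega> (j - 1, k + 1) \<and> reach_block r T \<omega> (j + 1, k + 1)"
    unfolding reach_block_def prod.case t z
  proof
    show "\<exists>x. \<bar>x - (z - 4 * int r)\<bar> \<le> 2 * int r \<and> even (x + (t + int T)) \<and> reach \<omega> (x, t + int T)"
      using final[of "z - 3 * int r"] by (intro exI[of _ "walk \<omega> (z - 3 * int r) T x t"]) auto
    show "\<exists>x. \<bar>x - (z + 4 * int r)\<bar> \<le> 2 * int r \<and> even (x + (t + int T)) \<and> reach \<omega> (x, t + int T)"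
      using final[of "z + 3 * int r"] by (intro exI[of _ "walk \<omega> (z + 3 * int r) T x t"]) auto
  qed
qed

lemma arrow_path_of_length_rtranclp:
  assumes "(has_arrow \<omega>)\<^sup>*\<^sup>* v w"
  shows "snd v \<le> snd w \<and> arrow_path_of_length \<omega> (nat (snd w - snd v)) v"
  using assms
proof (induction rule: converse_rtranclp_induct)
  case (step v u)
  have "snd u = snd v + 1"
    using step(1) by (cases "\<omega> v"; cases v) (auto simp: has_arrow_def)
  with step(3) have "snd v \<le> snd w" "nat (snd w - snd v) = Suc (nat (snd w - snd u))" by auto
  with step show ?case by (auto simp del: split_paired_Ex)
qed simp

text \<open>By compactness it suffices to find arbitrarily long finite paths. The origin makes block
  \<open>(0, 2)\<close> reached, hence active on every level, and level \<open>k\<close> yields a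
  path of length \<open>T * (20 ^ k * 2 - 2)\<close>.\<close>

lemma infinite_arrow_path_if_good:
  assumes "0 < T" and good: "\<And>k v. v \<in> seed_box \<Longrightarrow> \<not> bad (bad_block r T \<omega>) k v"
  shows "\<exists>p. p 0 = (0, 0) \<and> infinite_arrow_path \<omega> p"
  unfolding ex_infinite_arrow_path_iff
proof
  fix k
  have "reach_block r T \<omega> (0, 2)"
    unfolding reach_block_def reach_def by (auto intro!: exI[of _ 0])
  then have "active (reach_block r T \<omega>) k (0, 2)"
    by (rule active_seed[OF spreads_reach_block]) (rule good)
  then obtain j where "reach_block r T \<omega> (j, 20 ^ k * 2)"
    using active_base by blast
  then obtain x where "(has_arrow \<omega>)\<^sup>*\<^sup>* (0, 0) (x, int T * (20 ^ k * 2 - 2))"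
    unfolding reach_block_def reach_def by auto
  then have "arrow_path_of_length \<omega> (nat (int T * (20 ^ k * 2 - 2))) (0, 0)"
    using arrow_path_of_length_rtranclp by fastforce
  moreover have "k \<le> nat (int T * (20 ^ k * 2 - 2))"
  proof -
    have "Suc k \<le> 20 ^ k" by (induction k) auto
    then have "int (Suc k) \<le> int (20 ^ k)" by (simp only: of_nat_le_iff)
    then have "int k \<le> 1 * (20 ^ k * 2 - 2)" by simp
    also have "\<dots> \<le> int T * (20 ^ k * 2 - 2)"
      using assms(1) by (intro mult_right_mono) auto
    finally show ?thesis by simp
  qed
  ultimately show "arrow_path_of_length \<omega> k (0, 0)"
    by (rule arrow_path_of_length_antimono)
qed

section \<open>Percolation from rare, independent block failures\<close>

lemma prob_bad_blocks_le:
  fixes \<delta> \<epsilon> :: real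
  defines "M \<equiv> arrow_measure \<delta> \<epsilon>"
  assumes p: "\<And>v. v \<in> vertices \<Longrightarrow> measure M {\<omega> \<in> space M. bad_block r T \<omega> v} \<le> p"
    and S: "finite S" "S \<subseteq> vertices"
  shows "measure M {\<omega> \<in> space M. \<forall>v\<in>S. bad_block r T \<omega> v} \<le> p ^ card S"
  using S
proof (induction S rule: finite_induct)
  interpret prob_space M unfolding M_def by (rule prob_space_arrow_measure)
  case empty
  show ?case by (simp add: prob_space)
next
  interpret prob_space M unfolding M_def by (rule prob_space_arrow_measure)
  case (insert x S)
  have dep: "depends_on (\<Union>v\<in>S. region r T v) (\<lambda>\<omega>. \<forall>v\<in>S. bad_block r T \<omega> v)"
    using depends_on_bad_block unfolding depends_on_def by (metis UN_I)
  have disj: "region r T x \<inter> (\<Union>v\<in>S. region r T v) = {}"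
    using region_disjoint[of x _ r T] insert.prems insert.hyps(2) by blast
  have "prob {\<omega> \<in> space M. bad_block r T \<omega> x \<and> (\<forall>v\<in>S. bad_block r T \<omega> v)}
      = prob {\<omega> \<in> space M. bad_block r T \<omega> x} * prob {\<omega> \<in> space M. \<forall>v\<in>S. bad_block r T \<omega> v}"
    unfolding M_def
    by (rule arrow_measure_indep[OF finite_region region_vertices depends_on_bad_block _ _ dep disj])
      (use insert.hyps(1) finite_region in \<open>auto intro: UN_least[OF region_vertices, THEN subsetD]\<close>)
  also have "\<dots> \<le> p * p ^ card S"
    using insert p[of x] order_trans[OF measure_nonneg p[of x]] by (intro mult_mono insert.IH) auto
  finally show ?case using insert.hyps by simp
qed

lemma percolates_if_blocks_good:
  fixes \<delta> \<epsilon> :: real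
  defines "M \<equiv> arrow_measure \<delta> \<epsilon>"
  assumes "0 < T" and p: "\<And>v. v \<in> vertices \<Longrightarrow> measure M {\<omega> \<in> space M. bad_block r T \<omega> v} \<le> 1 / (2 * 380\<^sup>2)"
  shows "percolates \<delta> \<epsilon>"
proof -
  interpret prob_space M unfolding M_def by (rule prob_space_arrow_measure)
  have "0 < prob {\<omega> \<in> space M. \<forall>k. \<forall>v\<in>seed_box. \<not> bad (bad_block r T \<omega>) k v}"
  proof (rule prob_all_levels_good)
    show "{\<omega> \<in> space M. bad_block r T \<omega> v} \<in> events" if "v \<in> vertices" for v
      unfolding M_def by (rule arrow_measure_measurable[OF finite_region region_vertices depends_on_bad_block])
    show "prob {\<omega> \<in> space M. \<forall>v\<in>S. bad_block r T \<omega> v} \<le> (1 / (2 * 380\<^sup>2)) ^ card S"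
      if "finite S" "S \<subseteq> vertices" for S
      unfolding M_def by (rule prob_bad_blocks_le[OF p[unfolded M_def] that])
  qed auto
  also have "\<dots> \<le> prob (percolation_event \<delta> \<epsilon>)"
  proof (rule finite_measure_mono)
    show "{\<omega> \<in> space M. \<forall>k. \<forall>v\<in>seed_box. \<not> bad (bad_block r T \<omega>) k v} \<subseteq> percolation_event \<delta> \<epsilon>"
      unfolding percolation_event_def M_def[symmetric]
      using infinite_arrow_path_if_good[OF \<open>0 < T\<close>] by (intro Collect_mono) blast
    show "percolation_event \<delta> \<epsilon> \<in> events"
      unfolding M_def by (rule percolation_event_measurable)
  qed
  finally show ?thesis by (simp add: percolates_def M_def)
qed

section \<open>Existence of a percolating positive parameter\<close>

text \<open>A union bound over the exit at each of the \<open>T + 1\<close> times and the final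
  miss, each costing two tails. The condition on \<open>\<kappa>\<close> makes the contraction over
  \<open>T = \<kappa> * r\<close> steps outweigh the largest initial distance \<open>5 * r\<close>
  to the aim.\<close>

lemma prob_misses_le:
  fixes \<delta> \<epsilon> :: real
  defines "M \<equiv> arrow_measure \<delta> \<epsilon>"
  assumes \<delta>: "0 < \<delta>" "\<delta> \<le> 1" and \<epsilon>: "\<epsilon> \<in> {0..1}" and xt: "even (x + t)"
    and x: "\<bar>x - z\<bar> \<le> 2 * int r" and c: "c = z - 3 * int r \<or> c = z + 3 * int r"
    and \<kappa>: "(1 - \<delta>\<^sup>2 / 2) ^ \<kappa> * (1 + \<delta>) ^ 5 \<le> 1"
  shows "{\<omega> \<in> space M. misses r (\<kappa> * r) \<omega> z c x t} \<in> sets M"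
    and "measure M {\<omega> \<in> space M. misses r (\<kappa> * r) \<omega> z c x t}
      \<le> (2 * real (\<kappa> * r) + 4) * ((1 + 4 / \<delta>\<^sup>2) / (1 + \<delta>) ^ r)"
proof -
  interpret prob_space M unfolding M_def by (rule prob_space_arrow_measure)
  define \<rho> where "\<rho> = 1 - \<delta>\<^sup>2 / 2"
  define B where "B = (1 + 4 / \<delta>\<^sup>2) / (1 + \<delta>) ^ r"
  define T where "T = \<kappa> * r"
  have \<rho>: "0 \<le> \<rho>" "\<rho> \<le> 1"
    unfolding \<rho>_def using \<delta> power_le_one[of \<delta> 2] by auto
  have L: "1 \<le> 1 + \<delta>" using \<delta> by simp
  have meas: "{\<omega> \<in> space M. P (walk \<omega> c n x t)} \<in> events" for P n
    unfolding M_def by (rule arrow_measure_measurable[OF _ _ depends_on_walk[OF xt]]) auto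
  note tails = walk_tails[OF \<delta> \<epsilon> xt, folded \<rho>_def M_def]
  \<comment> \<open>At any time: a level exceeding the initial distance \<open>a\<close> by at least
    \<open>r\<close> is reached with small probability.\<close>
  have far: "(\<rho> ^ n * (1 + \<delta>) ^ a + 4 / \<delta>\<^sup>2) / (1 + \<delta>) ^ m \<le> B" if "a + r \<le> m" for n a m
  proof -
    have "\<rho> ^ n * (1 + \<delta>) ^ a + 4 / \<delta>\<^sup>2 \<le> 1 * (1 + \<delta>) ^ a + (1 + \<delta>) ^ a * (4 / \<delta>\<^sup>2)"
    proof (rule add_mono)
      show "\<rho> ^ n * (1 + \<delta>) ^ a \<le> 1 * (1 + \<delta>) ^ a"
        using \<rho> \<delta> by (intro mult_right_mono power_le_one) auto
      have "1 * (4 / \<delta>\<^sup>2) \<le> (1 + \<delta>) ^ a * (4 / \<delta>\<^sup>2)"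
        using L by (intro mult_right_mono one_le_power) auto
      then show "4 / \<delta>\<^sup>2 \<le> (1 + \<delta>) ^ a * (4 / \<delta>\<^sup>2)" by simp
    qed
    also have "\<dots> = (1 + \<delta>) ^ a * (1 + 4 / \<delta>\<^sup>2)" by (simp add: algebra_simps)
    finally have "(\<rho> ^ n * (1 + \<delta>) ^ a + 4 / \<delta>\<^sup>2) / (1 + \<delta>) ^ m
        \<le> (1 + \<delta>) ^ a * (1 + 4 / \<delta>\<^sup>2) / (1 + \<delta>) ^ m"
      using \<delta> by (intro divide_right_mono) auto
    also have "\<dots> \<le> (1 + \<delta>) ^ a * (1 + 4 / \<delta>\<^sup>2) / (1 + \<delta>) ^ (a + r)"
      using that L \<delta> by (intro divide_left_mono power_increasing) auto
    also have "\<dots> = B" using \<delta> by (simp add: B_def power_add)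
    finally show ?thesis .
  qed
  \<comment> \<open>At time \<open>T\<close> the starting point is forgotten, so distance
    \<open>r\<close> alone suffices.\<close>
  have late: "(\<rho> ^ T * (1 + \<delta>) ^ a + 4 / \<delta>\<^sup>2) / (1 + \<delta>) ^ r \<le> B" if "a \<le> 5 * r" for a
  proof -
    have "\<rho> ^ T * (1 + \<delta>) ^ a \<le> \<rho> ^ T * (1 + \<delta>) ^ (5 * r)"
      using that L \<rho> by (intro mult_left_mono power_increasing) auto
    also have "\<dots> = (\<rho> ^ \<kappa> * (1 + \<delta>) ^ 5) ^ r"
      by (simp add: T_def power_mult power_mult_distrib)
    also have "\<dots> \<le> 1"
      using \<kappa> \<rho> \<delta> unfolding \<rho>_def[symmetric] by (intro power_le_one) auto
    finally show ?thesis
      unfolding B_def using \<delta> by (intro divide_right_mono add_right_mono) auto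
  qed
  have exit: "prob {\<omega> \<in> space M. 4 * int r \<le> \<bar>walk \<omega> c n x t - z\<bar>} \<le> 2 * B" for n
  proof -
    \<comment> \<open>The boundary beyond the aim is \<open>r\<close> away from it, and the start is
      not on that side of the aim; the opposite boundary is \<open>7 * r\<close> away, more than the
      required \<open>5 * r + r\<close> when \<open>r\<close> is positive.\<close>
    obtain a b where ab: "c - int a = z - 4 * int r" "c + int b = z + 4 * int r"
      "nat (c - x) + r \<le> a" "nat (x - c) + r \<le> b"
    proof (cases "c = z + 3 * int r")
      case True
      then show ?thesis using x by (intro that[of "7 * r" r]) auto
    next
      case False
      then show ?thesis using x c by (intro that[of r "7 * r"]) auto
    qed
    have "{\<omega> \<in> space M. 4 * int r \<le> \<bar>walk \<omega> c n x t - z\<bar>}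
        \<subseteq> {\<omega> \<in> space M. walk \<omega> c n x t \<le> c - int a} \<union> {\<omega> \<in> space M. c + int b \<le> walk \<omega> c n x t}"
      using ab(1,2) by auto
    then have "prob {\<omega> \<in> space M. 4 * int r \<le> \<bar>walk \<omega> c n x t - z\<bar>}
        \<le> prob ({\<omega> \<in> space M. walk \<omega> c n x t \<le> c - int a} \<union> {\<omega> \<in> space M. c + int b \<le> walk \<omega> c n x t})"
      by (intro finite_measure_mono sets.Un meas)
    also have "\<dots> \<le> prob {\<omega> \<in> space M. walk \<omega> c n x t \<le> c - int a} + prob {\<omega> \<in> space M. c + int b \<le> walk \<omega> c n x t}"
      by (intro measure_Un_le meas)
    also have "\<dots> \<le> B + B"
      using order_trans[OF tails(1)[of c n a] far[OF ab(3)]] order_trans[OF tails(2)[of c b n] far[OF ab(4)]]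
      by (intro add_mono)
    finally show ?thesis by simp
  qed
  have "{\<omega> \<in> space M. int r < \<bar>walk \<omega> c T x t - c\<bar>}
      \<subseteq> {\<omega> \<in> space M. walk \<omega> c T x t \<le> c - int r} \<union> {\<omega> \<in> space M. c + int r \<le> walk \<omega> c T x t}"
    by auto
  then have "prob {\<omega> \<in> space M. int r < \<bar>walk \<omega> c T x t - c\<bar>}
      \<le> prob ({\<omega> \<in> space M. walk \<omega> c T x t \<le> c - int r} \<union> {\<omega> \<in> space M. c + int r \<le> walk \<omega> c T x t})"
    by (intro finite_measure_mono sets.Un meas)
  also have "\<dots> \<le> prob {\<omega> \<in> space M. walk \<omega> c T x t \<le> c - int r} + prob {\<omega> \<in> space M. c + int r \<le> walk \<omega> c T x t}"
    by (intro measure_Un_le meas)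
  also have "\<dots> \<le> B + B"
  proof -
    have "nat (c - x) \<le> 5 * r" "nat (x - c) \<le> 5 * r" using x c by auto
    then show ?thesis
      using order_trans[OF tails(1)[of c T r] late] order_trans[OF tails(2)[of c r T] late]
      by (intro add_mono) auto
  qed
  finally have final: "prob {\<omega> \<in> space M. int r < \<bar>walk \<omega> c T x t - c\<bar>} \<le> 2 * B" by simp
  have eq: "{\<omega> \<in> space M. misses r T \<omega> z c x t}
      = (\<Union>n\<in>{..T}. {\<omega> \<in> space M. 4 * int r \<le> \<bar>walk \<omega> c n x t - z\<bar>})
        \<union> {\<omega> \<in> space M. int r < \<bar>walk \<omega> c T x t - c\<bar>}"
    by (auto simp: misses_def)
  show "{\<omega> \<in> space M. misses r (\<kappa> * r) \<omega> z c x t} \<in> sets M"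
    unfolding T_def[symmetric] eq by (intro sets.Un sets.finite_UN meas) auto
  have "prob {\<omega> \<in> space M. misses r T \<omega> z c x t}
      \<le> prob (\<Union>n\<in>{..T}. {\<omega> \<in> space M. 4 * int r \<le> \<bar>walk \<omega> c n x t - z\<bar>})
        + prob {\<omega> \<in> space M. int r < \<bar>walk \<omega> c T x t - c\<bar>}"
    unfolding eq by (intro measure_Un_le sets.finite_UN meas) auto
  also have "\<dots> \<le> (\<Sum>n\<in>{..T}. 2 * B) + 2 * B"
    using meas exit
    by (intro add_mono final order_trans[OF finite_measure_subadditive_finite sum_mono]) auto
  also have "\<dots> = (2 * real T + 4) * B" by (simp add: algebra_simps)
  finally show "prob {\<omega> \<in> space M. misses r (\<kappa> * r) \<omega> z c x t} \<le> (2 * real (\<kappa> * r) + 4) * ((1 + 4 / \<delta>\<^sup>2) / (1 + \<delta>) ^ r)"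
    by (simp add: T_def B_def)
qed

lemma prob_bad_block_le:
  fixes \<delta> \<epsilon> :: real
  defines "M \<equiv> arrow_measure \<delta> \<epsilon>"
  assumes \<delta>: "0 < \<delta>" "\<delta> \<le> 1" and \<epsilon>: "\<epsilon> \<in> {0..1}"
    and \<kappa>: "(1 - \<delta>\<^sup>2 / 2) ^ \<kappa> * (1 + \<delta>) ^ 5 \<le> 1"
  shows "measure M {\<omega> \<in> space M. bad_block r (\<kappa> * r) \<omega> v}
    \<le> 2 * (4 * real r + 1) * (2 * real (\<kappa> * r) + 4) * ((1 + 4 / \<delta>\<^sup>2) / (1 + \<delta>) ^ r)
      + 8 * real r * real (\<kappa> * r) * \<epsilon>"
proof -
  interpret prob_space M unfolding M_def by (rule prob_space_arrow_measure)
  obtain j n where v: "v = (j, n)" by fastforce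
  define T where "T = \<kappa> * r"
  define z where "z = 4 * int r * j"
  define t where "t = int T * (n - 2)"
  define B where "B = (2 * real T + 4) * ((1 + 4 / \<delta>\<^sup>2) / (1 + \<delta>) ^ r)"
  \<comment> \<open>At most \<open>4 * r + 1\<close> starting points and two aims.\<close>
  define J where "J = {(x, c) \<in> {z - 2 * int r..z + 2 * int r} \<times> {z - 3 * int r, z + 3 * int r}. even (x + t)}"
  have finJ: "finite J"
    by (rule finite_subset[of _ "{z - 2 * int r..z + 2 * int r} \<times> {z - 3 * int r, z + 3 * int r}"])
      (auto simp: J_def)
  have J_iff: "(x, c) \<in> J \<longleftrightarrow> \<bar>x - z\<bar> \<le> 2 * int r \<and> even (x + t) \<and> (c = z - 3 * int r \<or> c = z + 3 * int r)" for x c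
    by (auto simp: J_def)
  have cardJ: "real (card J) \<le> 2 * (4 * real r + 1)"
  proof -
    have "card J \<le> card ({z - 2 * int r..z + 2 * int r} \<times> {z - 3 * int r, z + 3 * int r})"
      by (rule card_mono) (auto simp: J_def)
    also have "\<dots> = card {z - 2 * int r..z + 2 * int r} * card {z - 3 * int r, z + 3 * int r}"
      by (rule card_cartesian_product)
    also have "\<dots> \<le> (4 * r + 1) * 2"
      by (intro mult_mono) (auto simp: card_insert_if)
    finally show ?thesis by simp
  qed
  have B: "0 \<le> B" unfolding B_def using \<delta> by (intro mult_nonneg_nonneg divide_nonneg_nonneg) auto
  have blocked_meas: "{\<omega> \<in> space M. \<omega> u = Blocked} \<in> events" if "u \<in> region r T v" for u
    unfolding M_def using that region_vertices[of r T v]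
    by (intro arrow_measure_measurable[of "{u}"] depends_onI) auto
  have eq: "{\<omega> \<in> space M. bad_block r T \<omega> v}
      = (\<Union>(x, c)\<in>J. {\<omega> \<in> space M. misses r T \<omega> z c x t}) \<union> (\<Union>u\<in>region r T v. {\<omega> \<in> space M. \<omega> u = Blocked})"
    unfolding v bad_block_iff[OF z_def t_def] using J_iff by blast
  have miss: "{\<omega> \<in> space M. misses r T \<omega> z c x t} \<in> events" "prob {\<omega> \<in> space M. misses r T \<omega> z c x t} \<le> B"
    if "(x, c) \<in> J" for x c
  proof -
    have "even (x + t)" "\<bar>x - z\<bar> \<le> 2 * int r" "c = z - 3 * int r \<or> c = z + 3 * int r"
      using that J_iff by blast+
    from prob_misses_le[OF \<delta> \<epsilon> this \<kappa>]
    show "{\<omega> \<in> space M. misses r T \<omega> z c x t} \<in> events" "prob {\<omega> \<in> space M. misses r T \<omega> z c x t} \<le> B"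
      by (simp_all add: T_def B_def M_def)
  qed
  have "prob {\<omega> \<in> space M. bad_block r T \<omega> v}
      \<le> prob (\<Union>(x, c)\<in>J. {\<omega> \<in> space M. misses r T \<omega> z c x t})
        + prob (\<Union>u\<in>region r T v. {\<omega> \<in> space M. \<omega> u = Blocked})"
    unfolding eq using miss(1) blocked_meas finJ finite_region
    by (intro measure_Un_le sets.finite_UN) auto
  also have "prob (\<Union>(x, c)\<in>J. {\<omega> \<in> space M. misses r T \<omega> z c x t}) \<le> (\<Sum>(x, c)\<in>J. B)"
    using miss finJ unfolding case_prod_beta
    by (intro order_trans[OF finite_measure_subadditive_finite sum_mono]) auto
  also have "\<dots> = real (card J) * B" by (simp add: case_prod_beta)
  also have "\<dots> \<le> 2 * (4 * real r + 1) * B" using cardJ B by (rule mult_right_mono)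
  also have "prob (\<Union>u\<in>region r T v. {\<omega> \<in> space M. \<omega> u = Blocked}) \<le> (\<Sum>u\<in>region r T v. \<epsilon>)"
  proof (rule order_trans[OF finite_measure_subadditive_finite sum_mono])
    fix u assume "u \<in> region r T v"
    then have "u \<in> vertices" using region_vertices by blast
    then have "prob {\<omega> \<in> space M. \<omega> u \<in> {Blocked}} = \<delta> * \<epsilon>"
      unfolding M_def using arrow_measure_single[of \<delta> \<epsilon> u "{Blocked}"] \<delta> \<epsilon> by simp
    then show "prob {\<omega> \<in> space M. \<omega> u = Blocked} \<le> \<epsilon>"
      using \<delta> \<epsilon> by (simp add: mult_left_le_one_le)
  qed (use blocked_meas finite_region in auto)
  also have "\<dots> \<le> 8 * real r * real T * \<epsilon>"
  proof -
    have "real (card (region r T v)) \<le> real (8 * r * T)"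
      using card_region by (simp only: of_nat_le_iff)
    then have "real (card (region r T v)) * \<epsilon> \<le> 8 * real r * real T * \<epsilon>"
      using \<epsilon> by (intro mult_right_mono) auto
    then show ?thesis by simp
  qed
  finally show ?thesis by (simp add: T_def B_def mult.assoc)
qed

lemma exists_scale:
  fixes \<delta> p :: real
  assumes \<delta>: "0 < \<delta>" and p: "0 < p"
  shows "\<exists>r>0. 2 * (4 * real r + 1) * (2 * real (\<kappa> * r) + 4) * ((1 + 4 / \<delta>\<^sup>2) / (1 + \<delta>) ^ r) < p"
proof -
  \<comment> \<open>The square root splits the exponential evenly over the two factors
    \<open>r\<close> of the quadratic prefactor, reducing the limit to that of
    \<open>r * y ^ r\<close>.\<close>
  define y where "y = sqrt (1 / (1 + \<delta>))"
  have y: "0 < y" "y < 1" "y\<^sup>2 = 1 / (1 + \<delta>)" using \<delta> by (auto simp: y_def)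
  define K where "K = 10 * (2 * real \<kappa> + 4) * (1 + 4 / \<delta>\<^sup>2)"
  have "(\<lambda>r. real r * y ^ r) \<longlonglongrightarrow> 0"
    using y by (intro powser_times_n_limit_0) auto
  then have "(\<lambda>r. K * (real r * y ^ r)\<^sup>2) \<longlonglongrightarrow> K * 0\<^sup>2"
    by (intro tendsto_intros)
  then have "\<forall>\<^sub>F r in sequentially. K * (real r * y ^ r)\<^sup>2 < p"
    using p by (intro order_tendstoD) auto
  with eventually_gt_at_top[of 0] have "\<forall>\<^sub>F r in sequentially. 0 < r \<and> K * (real r * y ^ r)\<^sup>2 < p"
    by eventually_elim simp
  then obtain r where r: "0 < r" "K * (real r * y ^ r)\<^sup>2 < p"
    by (auto simp: eventually_sequentially)
  have "2 * (4 * real r + 1) * (2 * real (\<kappa> * r) + 4) \<le> 2 * (5 * real r) * ((2 * real \<kappa> + 4) * real r)"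
    using r(1) by (intro mult_mono) (auto simp: algebra_simps)
  then have "2 * (4 * real r + 1) * (2 * real (\<kappa> * r) + 4) * ((1 + 4 / \<delta>\<^sup>2) / (1 + \<delta>) ^ r)
      \<le> 2 * (5 * real r) * ((2 * real \<kappa> + 4) * real r) * ((1 + 4 / \<delta>\<^sup>2) / (1 + \<delta>) ^ r)"
    using \<delta> by (intro mult_right_mono) auto
  also have "\<dots> = K * ((real r)\<^sup>2 * (1 / (1 + \<delta>)) ^ r)"
    by (simp add: K_def power2_eq_square power_divide)
  also have "\<dots> = K * (real r * y ^ r)\<^sup>2"
    by (simp add: y(3)[symmetric] power_mult_distrib power_mult[symmetric] mult.commute)
  finally show ?thesis using r by (intro exI[of _ r]) simp
qed

text \<open>The choices are made in the order \<open>\<kappa>\<close>, \<open>r\<close>, \<epsilon>: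
  the walk bound is uniform in \<epsilon>, so the scale is fixed before \<epsilon> is chosen. Walks
  and blocked vertices each get half of the tolerated block failure probability
  \<open>p\<close>.\<close>

lemma percolates_small:
  fixes \<delta> :: real
  assumes \<delta>: "0 < \<delta>" "\<delta> \<le> 1"
  shows "\<exists>\<epsilon>>0. \<epsilon> \<le> 1 \<and> percolates \<delta> \<epsilon>"
proof -
  define p :: real where "p = 1 / (2 * 380\<^sup>2)"
  have p: "0 < p / 2" by (simp add: p_def)
  have \<rho>: "0 \<le> 1 - \<delta>\<^sup>2 / 2" "1 - \<delta>\<^sup>2 / 2 < 1"
    using \<delta> power_le_one[of \<delta> 2] by auto
  have "(\<lambda>n. (1 - \<delta>\<^sup>2 / 2) ^ n * (1 + \<delta>) ^ 5) \<longlonglongrightarrow> 0 * (1 + \<delta>) ^ 5"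
    using \<rho> by (intro tendsto_intros LIMSEQ_realpow_zero)
  then have "\<forall>\<^sub>F n in sequentially. (1 - \<delta>\<^sup>2 / 2) ^ n * (1 + \<delta>) ^ 5 < 1"
    by (intro order_tendstoD) auto
  with eventually_gt_at_top[of 0] have "\<forall>\<^sub>F n in sequentially. 0 < n \<and> (1 - \<delta>\<^sup>2 / 2) ^ n * (1 + \<delta>) ^ 5 < 1"
    by eventually_elim simp
  then obtain \<kappa> where \<kappa>: "0 < \<kappa>" "(1 - \<delta>\<^sup>2 / 2) ^ \<kappa> * (1 + \<delta>) ^ 5 < 1"
    by (auto simp: eventually_sequentially)
  obtain r where r: "0 < r"
    "2 * (4 * real r + 1) * (2 * real (\<kappa> * r) + 4) * ((1 + 4 / \<delta>\<^sup>2) / (1 + \<delta>) ^ r) < p / 2"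
    using exists_scale[OF \<delta>(1) p] by blast
  define c where "c = 8 * real r * real (\<kappa> * r)"
  define \<epsilon> where "\<epsilon> = min 1 (p / 2 / c)"
  have c: "0 < c" using r \<kappa> by (simp add: c_def)
  have \<epsilon>: "0 < \<epsilon>" "\<epsilon> \<le> 1" using c p by (auto simp: \<epsilon>_def)
  have c\<epsilon>: "c * \<epsilon> \<le> p / 2"
  proof -
    have "c * \<epsilon> \<le> c * (p / 2 / c)" unfolding \<epsilon>_def using c by (intro mult_left_mono) auto
    with c show ?thesis by simp
  qed
  have "percolates \<delta> \<epsilon>"
  proof (rule percolates_if_blocks_good)
    show "0 < \<kappa> * r" using r \<kappa> by simp
    fix v
    show "measure (arrow_measure \<delta> \<epsilon>) {\<omega> \<in> space (arrow_measure \<delta> \<epsilon>). bad_block r (\<kappa> * r) \<omega> v} \<le> 1 / (2 * 380\<^sup>2)"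
      using prob_bad_block_le[OF \<delta>, of \<epsilon> \<kappa> r v] \<epsilon> \<kappa> r(2) c\<epsilon>
      unfolding c_def[symmetric] p_def[symmetric] by simp
  qed
  with \<epsilon> show ?thesis by blast
qed

theorem theorem1:
  fixes \<delta> :: real
  assumes "\<delta> \<in> {0<..1}"
  shows "\<exists>\<epsilon>\<^sub>c :: real. \<epsilon>\<^sub>c > 0 \<and>
    (\<forall>\<epsilon>\<in>{0..1}. (\<epsilon> > \<epsilon>\<^sub>c \<longrightarrow> \<not> percolates \<delta> \<epsilon>) \<and> (\<epsilon> < \<epsilon>\<^sub>c \<longrightarrow> percolates \<delta> \<epsilon>))"
proof -
  define P where "P = {\<epsilon> \<in> {0..1}. percolates \<delta> \<epsilon>}"
  obtain \<epsilon>\<^sub>0 where \<epsilon>\<^sub>0: "0 < \<epsilon>\<^sub>0" "\<epsilon>\<^sub>0 \<in> P"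
    using percolates_small[of \<delta>] assms by (auto simp: P_def)
  have bdd: "bdd_above P" by (rule bdd_aboveI[of _ 1]) (auto simp: P_def)
  show ?thesis
  proof (intro exI[of _ "Sup P"] conjI ballI impI)
    show "0 < Sup P" using \<epsilon>\<^sub>0 cSup_upper[OF \<epsilon>\<^sub>0(2) bdd] by simp
    fix \<epsilon> :: real assume \<epsilon>: "\<epsilon> \<in> {0..1}"
    show "\<not> percolates \<delta> \<epsilon>" if "\<epsilon> > Sup P"
      using cSup_upper[OF _ bdd, of \<epsilon>] that \<epsilon> unfolding P_def by force
    show "percolates \<delta> \<epsilon>" if less: "\<epsilon> < Sup P"
    proof -
      \<comment> \<open>Below the supremum some larger parameter percolates, and antimonotonicity
        carries this down to \<epsilon>.\<close>
      have "P \<noteq> {}" using \<epsilon>\<^sub>0(2) by blast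
      then obtain \<epsilon>' where "\<epsilon>' \<in> P" "\<epsilon> < \<epsilon>'"
        using less_cSupD[OF _ less] by blast
      then show ?thesis
        by (intro percolates_antimono[of \<delta> \<epsilon> \<epsilon>']) (use \<epsilon> assms in \<open>simp_all add: P_def\<close>)
    qed
  qed
qed

end
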